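(* Let $n\ge 3$, let $\Gamma=C_n$ be the cycle graph with $n$ vertices, let $x_0$ be a vertex of $\Gamma$, and let $D=\lfloor n/2\rfloor$ be the diameter of $C_n$. Then, as $\mathbb{C}$-algebras, $\mathcal{T}_0(\Gamma,x_0)\cong\bigoplus_{i=1}^{D+1}\mathbb{C}$ and \[ \mathcal{T}_1(\Gamma,x_0)\cong\begin{cases} M_{D+1}(\mathbb{C})\oplus\bigoplus_{i=1}^{D-1}\mathbb{C} & \text{if } n \text{ is even},\\ M_{D+1}(\mathbb{C})\oplus\bigoplus_{i=1}^{D}\mathbb{C} & \text{if } n \text{ is odd}.\end{cases} \]
   Context: $C_n$ has vertex set $X=\{1,\dots,n\}$ and edge set $\{\{1,2\},\{2,3\},\dots,\{n-1,n\},\{n,1\}\}$. Let $A$ be its adjacency matrix, in the algebra $M_X(\mathbb{C})$ of complex matrices with rows and columns indexed by $X$, and let $E_{x_0}\in M_X(\mathbb{C})$ be the matrix with $(x_0,x_0)$-entry $1$ and all other entries $0$. $\mathbb{C}\langle S\rangle$ denotes the unital $\mathbb{C}$-subalgebra of $M_X(\mathbb{C})$ generated by $S$. Then $\mathcal{T}_0(\Gamma,x_0)=\mathbb{C}\langle A\rangle$ and $\mathcal{T}_1(\Gamma,x_0)=\mathbb{C}\langle A,E_{x_0}\rangle$. *)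

theory Defs
  imports
    "HOL-Library.FuncSet"
    "HOL-Algebra.Chinese_Remainder"
    "HOL-Algebra.Subrings"
    "Jordan_Normal_Form.Matrix"
begin

section \<open>Complex algebras\<close>

text \<open>
  The locale \<open>algebra\<close> of HOL-Algebra only covers commutative algebras.  Here a complex algebra
  is carried by a \<open>module\<close> record, which has ring operations and a scalar multiplication; no
  commutativity is involved.
\<close>

type_synonym 'b calg = "(complex, 'b) module"

definition calg_iso :: "'a calg \<Rightarrow> 'b calg \<Rightarrow> ('a \<Rightarrow> 'b) set" where
  "calg_iso A B =
     {h \<in> ring_iso A B. \<forall>c. \<forall>x\<in>carrier A. h (c \<odot>\<^bsub>A\<^esub> x) = c \<odot>\<^bsub>B\<^esub> h x}"

definition calg_isomorphic :: "'a calg \<Rightarrow> 'b calg \<Rightarrow> bool" (infix \<open>\<cong>\<^sub>\<C>\<close> 50) where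
  "A \<cong>\<^sub>\<C> B \<longleftrightarrow> calg_iso A B \<noteq> {}"

definition complex_calg :: "complex calg" where
  "complex_calg = \<lparr>carrier = UNIV, monoid.mult = (*), one = 1, zero = 0, add = (+), smult = (*)\<rparr>"

definition mat_calg :: "nat \<Rightarrow> complex mat calg" where
  "mat_calg n = ring_mat TYPE(complex) n \<lparr>smult = (\<cdot>\<^sub>m)\<rparr>"

definition calg_sum :: "'a calg \<Rightarrow> 'b calg \<Rightarrow> ('a \<times> 'b) calg" (infixr \<open>\<oplus>\<^sub>\<C>\<close> 65) where
  "A \<oplus>\<^sub>\<C> B = ring.extend (RDirProd A B)
     \<lparr>smult = (\<lambda>c p. (c \<odot>\<^bsub>A\<^esub> fst p, c \<odot>\<^bsub>B\<^esub> snd p))\<rparr>"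

text \<open>
  The direct sum of a family of algebras.  The full product is used as carrier, so this is the
  direct sum only for a finite index set.
\<close>

definition calg_Sum :: "'i set \<Rightarrow> ('i \<Rightarrow> 'b calg) \<Rightarrow> ('i \<Rightarrow> 'b) calg" where
  "calg_Sum I A = \<lparr>
     carrier = (\<Pi>\<^sub>E i\<in>I. carrier (A i)),
     monoid.mult = (\<lambda>f g. \<lambda>i\<in>I. f i \<otimes>\<^bsub>A i\<^esub> g i),
     one = (\<lambda>i\<in>I. \<one>\<^bsub>A i\<^esub>),
     zero = (\<lambda>i\<in>I. \<zero>\<^bsub>A i\<^esub>),
     add = (\<lambda>f g. \<lambda>i\<in>I. f i \<oplus>\<^bsub>A i\<^esub> g i),
     smult = (\<lambda>c f. \<lambda>i\<in>I. c \<odot>\<^bsub>A i\<^esub> f i)\<rparr>"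

definition unital_subalgebra :: "'b set \<Rightarrow> 'b calg \<Rightarrow> bool" where
  "unital_subalgebra B A \<longleftrightarrow> subring B A \<and> (\<forall>c. \<forall>x\<in>B. c \<odot>\<^bsub>A\<^esub> x \<in> B)"

definition generated_calg :: "'b calg \<Rightarrow> 'b set \<Rightarrow> 'b calg" where
  "generated_calg A S = A\<lparr>carrier := \<Inter>{B. unital_subalgebra B A \<and> S \<subseteq> B}\<rparr>"

section \<open>Graphs on the vertex set \<open>{1..n}\<close>\<close>

text \<open>
  A graph is given by its number \<open>n\<close> of vertices and its set of edges, each edge being a
  two-element set of vertices.
\<close>

definition cycle_edges :: "nat \<Rightarrow> nat set set" where
  "cycle_edges n = {{i, i + 1} | i. 1 \<le> i \<and> i < n} \<union> {{n, 1}}"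

text \<open>The distance is the least length of a walk; it is meaningful only for connected graphs.\<close>

definition graph_dist :: "nat set set \<Rightarrow> nat \<Rightarrow> nat \<Rightarrow> nat" where
  "graph_dist E x y = (LEAST k. (x, y) \<in> {(u, v). {u, v} \<in> E} ^^ k)"

definition graph_diameter :: "nat \<Rightarrow> nat set set \<Rightarrow> nat" where
  "graph_diameter n E = Max {graph_dist E x y | x y. x \<in> {1..n} \<and> y \<in> {1..n}}"

text \<open>Matrix indices start at 0, so that row and column \<open>i\<close> belong to the vertex \<open>i + 1\<close>.\<close>

definition adjacency_mat :: "nat \<Rightarrow> nat set set \<Rightarrow> complex mat" where
  "adjacency_mat n E = mat n n (\<lambda>(i, j). if {i + 1, j + 1} \<in> E then 1 else 0)"

definition vertex_mat :: "nat \<Rightarrow> nat \<Rightarrow> complex mat" where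
  "vertex_mat n x = mat n n (\<lambda>(i, j). if i + 1 = x \<and> j + 1 = x then 1 else 0)"

definition T0 :: "nat \<Rightarrow> nat set set \<Rightarrow> nat \<Rightarrow> complex mat calg" where
  "T0 n E x = generated_calg (mat_calg n) {adjacency_mat n E}"

definition T1 :: "nat \<Rightarrow> nat set set \<Rightarrow> nat \<Rightarrow> complex mat calg" where
  "T1 n E x = generated_calg (mat_calg n) {adjacency_mat n E, vertex_mat n x}"

end

theory Submission
  imports Defs "Jordan_Normal_Form.Determinant"
begin

text \<open>
  Each target algebra \<open>C\<close> embeds into \<open>M\<^sub>n\<close> as \<open>Z \<mapsto> P * h Z * P\<^sup>-\<^sup>1\<close>, where \<open>h\<close> is a (block) diagonal
  embedding and the columns of \<open>P\<close> are a basis of \<open>\<complex>\<^sup>n\<close>.  If this map hits the given generators and their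
  preimages generate \<open>C\<close>, then its image is the generated algebra.  For \<open>\<T>\<^sub>0\<close>, the columns form the
  discrete Fourier basis, and \<open>C\<close> is generated by the list of distinct eigenvalues, by Lagrange
  interpolation.  For \<open>\<T>\<^sub>1\<close>, split \<open>\<complex>\<^sup>n\<close> under the reflection fixing \<open>x\<^sub>0\<close>: on symmetric vectors
  the adjacency matrix becomes an irreducible tridiagonal matrix, which together with the matrix unit
  at \<open>(0, 0)\<close> generates a full matrix algebra; on antisymmetric vectors the vertex matrix vanishes
  and the adjacency matrix is diagonal with distinct eigenvalues in the sine basis.
\<close>

section \<open>Algebra homomorphisms and generated algebras\<close>

definition calg_hom :: "'a calg \<Rightarrow> 'b calg \<Rightarrow> ('a \<Rightarrow> 'b) set" where
  "calg_hom A B =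
     {h \<in> Ring.ring_hom A B. \<forall>c. \<forall>x\<in>carrier A. h (c \<odot>\<^bsub>A\<^esub> x) = c \<odot>\<^bsub>B\<^esub> h x}"

text \<open>A \<open>calg\<close> record carries no module axioms and \<open>ring\<close> ignores
  \<open>smult\<close>, so closure under scalars is a separate condition.\<close>

definition smult_closed :: "'a calg \<Rightarrow> bool" where
  "smult_closed A \<longleftrightarrow> (\<forall>c. \<forall>x\<in>carrier A. c \<odot>\<^bsub>A\<^esub> x \<in> carrier A)"

definition generates_calg :: "'a calg \<Rightarrow> 'a set \<Rightarrow> bool" where
  "generates_calg A S \<longleftrightarrow> (\<forall>B. unital_subalgebra B A \<longrightarrow> S \<subseteq> B \<longrightarrow> B = carrier A)"

lemma calg_hom_ring_hom_ring:
  assumes "ring A" "ring B" "h \<in> calg_hom A B"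
  shows "ring_hom_ring A B h"
  using assms by (auto simp: calg_hom_def intro: ring_hom_ringI2)

lemma unital_subalgebraD:
  assumes "unital_subalgebra B A"
  shows "B \<subseteq> carrier A" "\<zero>\<^bsub>A\<^esub> \<in> B" "\<one>\<^bsub>A\<^esub> \<in> B"
    "\<And>x. x \<in> B \<Longrightarrow> \<ominus>\<^bsub>A\<^esub> x \<in> B"
    "\<And>x y. x \<in> B \<Longrightarrow> y \<in> B \<Longrightarrow> x \<otimes>\<^bsub>A\<^esub> y \<in> B"
    "\<And>x y. x \<in> B \<Longrightarrow> y \<in> B \<Longrightarrow> x \<oplus>\<^bsub>A\<^esub> y \<in> B"
    "\<And>c x. x \<in> B \<Longrightarrow> c \<odot>\<^bsub>A\<^esub> x \<in> B"
  using assms subringE[of B A] by (auto simp: unital_subalgebra_def)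

lemma unital_subalgebra_vimage:
  assumes A: "ring A" "smult_closed A" and B: "ring B"
    and h: "h \<in> calg_hom A B" and U: "unital_subalgebra U B"
  shows "unital_subalgebra {x \<in> carrier A. h x \<in> U} A"
proof -
  interpret ring_hom_ring A B h
    using A(1) B h by (rule calg_hom_ring_hom_ring)
  have "subring {x \<in> carrier A. h x \<in> U} A"
    by (rule R.subringI) (use unital_subalgebraD[OF U] in auto)
  moreover have "h (c \<odot>\<^bsub>A\<^esub> x) \<in> U" if "x \<in> carrier A" "h x \<in> U" for c x
    using that h unital_subalgebraD(7)[OF U] by (auto simp: calg_hom_def)
  ultimately show ?thesis
    using A(2) by (auto simp: unital_subalgebra_def smult_closed_def)
qed

lemma unital_subalgebra_image:
  assumes A: "ring A" "smult_closed A" and B: "ring B" and h: "h \<in> calg_hom A B"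
  shows "unital_subalgebra (h ` carrier A) B"
proof -
  interpret ring_hom_ring A B h
    using A(1) B h by (rule calg_hom_ring_hom_ring)
  have "subring (h ` carrier A) B"
    by (rule img_is_subring) (rule R.carrier_is_subring)
  moreover have "c \<odot>\<^bsub>B\<^esub> h x \<in> h ` carrier A" if "x \<in> carrier A" for c x
  proof (rule image_eqI)
    show "c \<odot>\<^bsub>B\<^esub> h x = h (c \<odot>\<^bsub>A\<^esub> x)" "c \<odot>\<^bsub>A\<^esub> x \<in> carrier A"
      using that h A(2) by (auto simp: calg_hom_def smult_closed_def)
  qed
  ultimately show ?thesis
    by (auto simp: unital_subalgebra_def)
qed

text \<open>Two inclusions: the image of \<open>h\<close> is itself a subalgebra through the
  generators, and the preimage of any such subalgebra contains \<open>S\<close>, hence is all of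
  \<open>A\<close>.\<close>

lemma carrier_generated_calg_image:
  assumes A: "ring A" "smult_closed A" and B: "ring B" and h: "h \<in> calg_hom A B"
    and S: "S \<subseteq> carrier A" "generates_calg A S"
  shows "carrier (generated_calg B (h ` S)) = h ` carrier A"
proof -
  have "h ` carrier A \<subseteq> U" if U: "unital_subalgebra U B" "h ` S \<subseteq> U" for U
  proof -
    have "{x \<in> carrier A. h x \<in> U} = carrier A"
      using S U unital_subalgebra_vimage[OF A B h U(1)] by (auto simp: generates_calg_def)
    then show ?thesis by blast
  qed
  moreover have "unital_subalgebra (h ` carrier A) B" "h ` S \<subseteq> h ` carrier A"
    using unital_subalgebra_image[OF A B h] S by auto
  ultimately show ?thesis
    unfolding generated_calg_def by auto
qed

text \<open>The isomorphism is the inverse of \<open>h\<close> on its image, because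
  \<open>A\<close> stands on the right.\<close>

lemma generated_calg_isomorphic:
  assumes A: "ring A" "smult_closed A" and B: "ring B" and h: "h \<in> calg_hom A B"
    and inj: "inj_on h (carrier A)"
    and S: "S \<subseteq> carrier A" "generates_calg A S"
  shows "generated_calg B (h ` S) \<cong>\<^sub>\<C> A"
proof -
  let ?G = "generated_calg B (h ` S)"
  have car: "carrier ?G = h ` carrier A"
    by (rule carrier_generated_calg_image[OF A B h S])
  have fields: "monoid.mult ?G = monoid.mult B" "one ?G = one B" "add ?G = add B"
    "module.smult ?G = module.smult B"
    by (auto simp: generated_calg_def)
  have "h \<in> ring_iso A ?G"
    using h inj by (auto simp: ring_iso_def Ring.ring_hom_def calg_hom_def car fields bij_betw_def)
  then have "inv_into (carrier A) h \<in> ring_iso ?G A"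
    by (rule ring_iso_set_sym[OF A(1)])
  moreover have "inv_into (carrier A) h (c \<odot>\<^bsub>B\<^esub> h x) = c \<odot>\<^bsub>A\<^esub> inv_into (carrier A) h (h x)"
    if "x \<in> carrier A" for c x
  proof -
    have "c \<odot>\<^bsub>B\<^esub> h x = h (c \<odot>\<^bsub>A\<^esub> x)" "c \<odot>\<^bsub>A\<^esub> x \<in> carrier A"
      using h A(2) that by (auto simp: calg_hom_def smult_closed_def)
    then show ?thesis using inj that by simp
  qed
  ultimately show ?thesis
    unfolding calg_isomorphic_def calg_iso_def by (auto simp: car fields)
qed

section \<open>The target algebras\<close>

lemma mat_calg_simps [simp]:
  "carrier (mat_calg n) = carrier_mat n n" "monoid.mult (mat_calg n) = (*)" "add (mat_calg n) = (+)"
  "one (mat_calg n) = 1\<^sub>m n" "zero (mat_calg n) = 0\<^sub>m n n" "module.smult (mat_calg n) = (\<cdot>\<^sub>m)"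
  by (auto simp: mat_calg_def ring_mat_def)

lemma ring_mat_calg: "ring (mat_calg n)"
  unfolding mat_calg_def by (rule ring_mat)

lemma smult_closed_mat_calg: "smult_closed (mat_calg n)"
  by (auto simp: smult_closed_def)

abbreviation complex_power :: "'i set \<Rightarrow> ('i \<Rightarrow> complex) calg" where
  "complex_power I \<equiv> calg_Sum I (\<lambda>_. complex_calg)"

lemma complex_power_simps [simp]:
  "carrier (complex_power I) = I \<rightarrow>\<^sub>E UNIV"
  "monoid.mult (complex_power I) = (\<lambda>f g. \<lambda>i\<in>I. f i * g i)"
  "add (complex_power I) = (\<lambda>f g. \<lambda>i\<in>I. f i + g i)"
  "one (complex_power I) = (\<lambda>i\<in>I. 1)" "zero (complex_power I) = (\<lambda>i\<in>I. 0)"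
  "module.smult (complex_power I) = (\<lambda>c f. \<lambda>i\<in>I. c * f i)"
  by (auto simp: calg_Sum_def complex_calg_def)

lemma ring_complex_power: "ring (complex_power I)"
proof (rule ringI)
  show "abelian_group (complex_power I)"
  proof (rule abelian_groupI, goal_cases)
    \<comment> \<open>Case 6 asks for an additive inverse; the restriction keeps the witness
      extensional, hence in the carrier.\<close>
    case (6 f)
    then show ?case
      by (intro bexI[of _ "\<lambda>i\<in>I. - f i"]) auto
  qed (auto simp: fun_eq_iff PiE_def extensional_def)
  show "monoid (complex_power I)"
    by unfold_locales (auto simp: fun_eq_iff PiE_def extensional_def)
qed (auto simp: fun_eq_iff algebra_simps)

lemma smult_closed_complex_power: "smult_closed (complex_power I)"
  by (auto simp: smult_closed_def)

lemma calg_sum_simps [simp]: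
  "carrier (A \<oplus>\<^sub>\<C> B) = carrier A \<times> carrier B"
  "monoid.mult (A \<oplus>\<^sub>\<C> B) p q = (fst p \<otimes>\<^bsub>A\<^esub> fst q, snd p \<otimes>\<^bsub>B\<^esub> snd q)"
  "add (A \<oplus>\<^sub>\<C> B) p q = (fst p \<oplus>\<^bsub>A\<^esub> fst q, snd p \<oplus>\<^bsub>B\<^esub> snd q)"
  "one (A \<oplus>\<^sub>\<C> B) = (\<one>\<^bsub>A\<^esub>, \<one>\<^bsub>B\<^esub>)" "zero (A \<oplus>\<^sub>\<C> B) = (\<zero>\<^bsub>A\<^esub>, \<zero>\<^bsub>B\<^esub>)"
  "module.smult (A \<oplus>\<^sub>\<C> B) c p = (c \<odot>\<^bsub>A\<^esub> fst p, c \<odot>\<^bsub>B\<^esub> snd p)"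
  by (auto simp: calg_sum_def RDirProd_def DirProd_def ring.defs monoid.defs split: prod.splits)

lemma ring_calg_sum:
  assumes "ring A" "ring B"
  shows "ring (A \<oplus>\<^sub>\<C> B)"
proof -
  interpret A: ring A by fact
  interpret B: ring B by fact
  show ?thesis
  proof (rule ringI)
    show "abelian_group (A \<oplus>\<^sub>\<C> B)"
    proof (rule abelian_groupI, goal_cases)
      case (6 p)
      then show ?case
        by (intro bexI[of _ "(\<ominus>\<^bsub>A\<^esub> fst p, \<ominus>\<^bsub>B\<^esub> snd p)"]) (auto simp: A.l_neg B.l_neg)
    qed (auto simp: A.a_assoc B.a_assoc intro: A.a_comm B.a_comm)
    show "monoid (A \<oplus>\<^sub>\<C> B)"
      by unfold_locales (auto simp: A.m_assoc B.m_assoc)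
  qed (auto simp: A.l_distr B.l_distr A.r_distr B.r_distr)
qed

lemma smult_closed_calg_sum:
  "smult_closed A \<Longrightarrow> smult_closed B \<Longrightarrow> smult_closed (A \<oplus>\<^sub>\<C> B)"
  by (auto simp: smult_closed_def)

section \<open>Generators of the target algebras\<close>

text \<open>A subalgebra contains every polynomial in \<open>f\<close>; the one with roots
  \<open>c l\<close> is built factor by factor from \<open>f\<close> minus a multiple of the
  identity.\<close>

lemma unital_subalgebra_prod_diff:
  assumes U: "unital_subalgebra U (complex_power I)" and f: "f \<in> U" and "finite J"
  shows "(\<lambda>i\<in>I. \<Prod>l\<in>J. (f i - c l)) \<in> U"
  using \<open>finite J\<close>
proof induction
  case empty
  show ?case using unital_subalgebraD(3)[OF U] by (simp add: restrict_def)
next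
  case (insert l J)
  let ?p = "\<lambda>i\<in>I. \<Prod>l\<in>J. (f i - c l)"
  let ?q = "f \<oplus>\<^bsub>complex_power I\<^esub> ((- c l) \<odot>\<^bsub>complex_power I\<^esub> \<one>\<^bsub>complex_power I\<^esub>)"
  have "?q \<in> U"
    using U f by (intro unital_subalgebraD[OF U])
  then have "?q \<otimes>\<^bsub>complex_power I\<^esub> ?p \<in> U"
    using insert.IH by (rule unital_subalgebraD(5)[OF U])
  also have "?q \<otimes>\<^bsub>complex_power I\<^esub> ?p = (\<lambda>i\<in>I. \<Prod>l\<in>insert l J. (f i - c l))"
    using insert.hyps by (auto simp: fun_eq_iff)
  finally show ?case .
qed

lemma unital_subalgebra_linear_combination:
  assumes U: "unital_subalgebra U (complex_power I)" and "\<And>k. k \<in> J \<Longrightarrow> g k \<in> U" and "finite J"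
  shows "(\<lambda>i\<in>I. \<Sum>k\<in>J. c k * g k i) \<in> U"
  using assms(3,2)
proof induction
  case empty
  show ?case using unital_subalgebraD(2)[OF U] by (simp add: restrict_def)
next
  case (insert l J)
  let ?C = "complex_power I"
  let ?p = "(c l \<odot>\<^bsub>?C\<^esub> g l) \<oplus>\<^bsub>?C\<^esub> (\<lambda>i\<in>I. \<Sum>k\<in>J. c k * g k i)"
  have "(\<lambda>i\<in>I. \<Sum>k\<in>J. c k * g k i) \<in> U" "g l \<in> U"
    using insert by blast+
  then have "?p \<in> U"
    by (intro unital_subalgebraD[OF U])
  also have "?p = (\<lambda>i\<in>I. \<Sum>k\<in>insert l J. c k * g k i)"
    using insert.hyps by (auto simp: fun_eq_iff)
  finally show ?case .
qed

text \<open>The products below are, up to scaling, the Lagrange idempotents.\<close>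

lemma generates_complex_power:
  assumes I: "finite I" and inj: "inj_on f I"
  shows "generates_calg (complex_power I) {f}"
  unfolding generates_calg_def
proof (intro allI impI equalityI subsetI)
  fix U d assume U: "unital_subalgebra U (complex_power I)" and f: "{f} \<subseteq> U"
    and d: "d \<in> carrier (complex_power I)"
  define L where "L k = (\<lambda>i\<in>I. \<Prod>l\<in>I - {k}. (f i - f l))" for k
  have L: "L k \<in> U" for k
    unfolding L_def using U f I by (intro unital_subalgebra_prod_diff) auto
  have L_off: "L k i = 0" if "i \<in> I" "k \<noteq> i" for i k
    using that I by (auto simp: L_def)
  have L_diag: "L k k \<noteq> 0" if "k \<in> I" for k
    using that I inj by (auto simp: L_def inj_on_def)
  \<comment> \<open>Lagrange interpolation: on \<open>I\<close> the quotient
    \<open>L k i / L k k\<close> is 1 at \<open>i = k\<close> and 0 elsewhere, the denominator being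
    nonzero by injectivity of \<open>f\<close>.\<close>
  have "(\<lambda>i\<in>I. \<Sum>k\<in>I. d k / L k k * L k i) \<in> U"
    using U L I by (intro unital_subalgebra_linear_combination) auto
  also have "(\<lambda>i\<in>I. \<Sum>k\<in>I. d k / L k k * L k i) = d"
  proof
    fix i
    show "(\<lambda>i\<in>I. \<Sum>k\<in>I. d k / L k k * L k i) i = d i"
    proof (cases "i \<in> I")
      case True
      have "(\<Sum>k\<in>I. d k / L k k * L k i) = (\<Sum>k\<in>I. if k = i then d i else 0)"
        using True L_off L_diag by (intro sum.cong) auto
      then show ?thesis using True I by simp
    qed (use d in \<open>auto simp: PiE_def extensional_def\<close>)
  qed
  finally show "d \<in> U" .
next
  fix U d assume "unital_subalgebra U (complex_power I)" "d \<in> U"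
  then show "d \<in> carrier (complex_power I)" using unital_subalgebraD(1) by blast
qed

section \<open>Matrix units and the full matrix algebra\<close>

definition mat_unit :: "nat \<Rightarrow> nat \<Rightarrow> nat \<Rightarrow> complex mat" where
  "mat_unit n i j = mat n n (\<lambda>(a, b). if a = i \<and> b = j then 1 else 0)"

lemma mat_unit_carrier [simp]: "mat_unit n i j \<in> carrier_mat n n"
  by (simp add: mat_unit_def)

lemma mat_unit_index [simp]:
  "a < n \<Longrightarrow> b < n \<Longrightarrow> mat_unit n i j $$ (a, b) = (if a = i \<and> b = j then 1 else 0)"
  by (simp add: mat_unit_def)

lemma index_mult_mat_sum:
  assumes "A \<in> carrier_mat n k" "B \<in> carrier_mat k m" "i < n" "j < m"
  shows "(A * B) $$ (i, j) = (\<Sum>l<k. A $$ (i, l) * B $$ (l, j))"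
  using assms by (simp add: scalar_prod_def lessThan_atLeast0)

text \<open>Neither identity nor products are required: the sets \<open>V\<close> below are not
  known to contain \<open>1\<^sub>m n\<close> before all units have been found.\<close>

definition mat_subspace :: "nat \<Rightarrow> complex mat set \<Rightarrow> bool" where
  "mat_subspace n V \<longleftrightarrow> V \<subseteq> carrier_mat n n \<and> 0\<^sub>m n n \<in> V \<and>
     (\<forall>x\<in>V. \<forall>y\<in>V. x + y \<in> V) \<and> (\<forall>c. \<forall>x\<in>V. c \<cdot>\<^sub>m x \<in> V)"

text \<open>Writing the combination entrywise turns later matrix identities into finite sums of
  complex numbers.\<close>

lemma mat_subspace_linear_combination:
  assumes V: "mat_subspace n V" and "\<And>k. k \<in> J \<Longrightarrow> g k \<in> V" and "finite J"
  shows "mat n n (\<lambda>(a, b). \<Sum>k\<in>J. c k * g k $$ (a, b)) \<in> V"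
  using assms(3,2)
proof induction
  case empty
  have "mat n n (\<lambda>(a, b). \<Sum>k\<in>{}. c k * g k $$ (a, b)) = 0\<^sub>m n n"
    by (rule eq_matI) auto
  then show ?case using V unfolding mat_subspace_def by metis
next
  case (insert l J)
  let ?p = "c l \<cdot>\<^sub>m g l + mat n n (\<lambda>(a, b). \<Sum>k\<in>J. c k * g k $$ (a, b))"
  have "g l \<in> V" "mat n n (\<lambda>(a, b). \<Sum>k\<in>J. c k * g k $$ (a, b)) \<in> V"
    using insert by blast+
  then have "?p \<in> V" and g: "g l \<in> carrier_mat n n"
    using V unfolding mat_subspace_def by blast+
  have "?p = mat n n (\<lambda>(a, b). \<Sum>k\<in>insert l J. c k * g k $$ (a, b))"
    by (rule eq_matI) (use insert.hyps g in auto)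
  then show ?case
    using \<open>?p \<in> V\<close> by (rule subst[of _ _ "\<lambda>x. x \<in> V"])
qed

lemma mat_subspace_all:
  assumes V: "mat_subspace n V" and units: "\<And>i j. i < n \<Longrightarrow> j < n \<Longrightarrow> mat_unit n i j \<in> V"
  shows "V = carrier_mat n n"
proof
  show "V \<subseteq> carrier_mat n n" using V by (simp add: mat_subspace_def)
  show "carrier_mat n n \<subseteq> V"
  proof
    fix Y :: "complex mat" assume Y: "Y \<in> carrier_mat n n"
    let ?J = "{..<n} \<times> {..<n}"
    have "mat n n (\<lambda>(a, b). \<Sum>k\<in>?J. Y $$ k * mat_unit n (fst k) (snd k) $$ (a, b)) \<in> V"
      by (intro mat_subspace_linear_combination[OF V]) (auto intro: units)
    also have "mat n n (\<lambda>(a, b). \<Sum>k\<in>?J. Y $$ k * mat_unit n (fst k) (snd k) $$ (a, b)) = Y"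
    proof (rule eq_matI)
      fix a b assume "a < dim_row Y" "b < dim_col Y"
      then have ab: "a < n" "b < n" using Y by auto
      then have "(\<Sum>k\<in>?J. Y $$ k * mat_unit n (fst k) (snd k) $$ (a, b))
          = (\<Sum>k\<in>?J. if k = (a, b) then Y $$ (a, b) else 0)"
        by (intro sum.cong) auto
      with ab show "mat n n (\<lambda>(a, b). \<Sum>k\<in>?J. Y $$ k * mat_unit n (fst k) (snd k) $$ (a, b)) $$ (a, b)
          = Y $$ (a, b)"
        by simp
    qed (use Y in auto)
    finally show "Y \<in> V" .
  qed
qed

text \<open>An unreduced upper Hessenberg matrix \<open>T\<close> moves the unit in row 0 to every other row: up to
  units in earlier rows, \<open>T\<close> maps the unit in row \<open>i\<close> to a nonzero multiple of the one in row \<open>i + 1\<close>.\<close>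

lemma mat_unit_rows:
  assumes V: "mat_subspace n V" and T: "T \<in> carrier_mat n n"
    and mult: "\<And>x. x \<in> V \<Longrightarrow> T * x \<in> V"
    and sub: "\<And>i. Suc i < n \<Longrightarrow> T $$ (Suc i, i) \<noteq> 0"
    and zero: "\<And>i j. i < n \<Longrightarrow> Suc j < i \<Longrightarrow> T $$ (i, j) = 0"
    and unit0: "mat_unit n 0 j \<in> V" and "i < n" "j < n"
  shows "mat_unit n i j \<in> V"
  using \<open>i < n\<close>
proof (induction i rule: less_induct)
  case (less i)
  show ?case
  proof (cases i)
    case 0
    then show ?thesis using unit0 by simp
  next
    case (Suc r)
    define t where "t = T $$ (Suc r, r)"
    have t: "t \<noteq> 0" using sub[of r] less.prems Suc by (simp add: t_def)
    \<comment> \<open>\<open>T * mat_unit n r j\<close> is the sum over \<open>k\<close> of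
      \<open>T $$ (k, r)\<close> times the unit in row \<open>k\<close>. Solving for the unit in row
      \<open>Suc r\<close> gives these coefficients.\<close>
    define g where "g k = (if k = Suc r then T * mat_unit n r j else mat_unit n k j)" for k
    define c where "c k = (if k = Suc r then 1 / t else - T $$ (k, r) / t)" for k
    have "mat n n (\<lambda>(a, b). \<Sum>k\<in>{..Suc r}. c k * g k $$ (a, b)) \<in> V"
      using less Suc by (intro mat_subspace_linear_combination[OF V]) (auto simp: g_def intro!: mult)
    also have "mat n n (\<lambda>(a, b). \<Sum>k\<in>{..Suc r}. c k * g k $$ (a, b)) = mat_unit n i j"
    proof (rule eq_matI)
      fix a b assume "a < dim_row (mat_unit n i j)" "b < dim_col (mat_unit n i j)"
      then have ab: "a < n" "b < n" by (auto simp: mat_unit_def)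
      have r: "r < n" using less.prems Suc by simp
      have "(T * mat_unit n r j) $$ (a, b) = (\<Sum>l<n. if l = r then T $$ (a, r) * (if b = j then 1 else 0) else 0)"
        unfolding index_mult_mat_sum[OF T mat_unit_carrier ab] by (rule sum.cong[OF refl]) (use ab in auto)
      also have "\<dots> = T $$ (a, r) * (if b = j then 1 else 0)"
        using r by simp
      finally have Tu: "(T * mat_unit n r j) $$ (a, b) = T $$ (a, r) * (if b = j then 1 else 0)" .
      have "(\<Sum>k\<le>r. c k * g k $$ (a, b)) = (\<Sum>k\<le>r. if k = a then - T $$ (a, r) / t * (if b = j then 1 else 0) else 0)"
        using ab by (intro sum.cong) (auto simp: c_def g_def)
      also have "\<dots> = (if a \<le> r then - T $$ (a, r) / t * (if b = j then 1 else 0) else 0)"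
        by simp
      finally have "(\<Sum>k\<le>Suc r. c k * g k $$ (a, b)) =
          (if a \<le> r then - T $$ (a, r) / t * (if b = j then 1 else 0) else 0)
          + T $$ (a, r) / t * (if b = j then 1 else 0)"
        by (simp add: c_def g_def Tu)
      \<comment> \<open>Rows up to \<open>r\<close> cancel, row \<open>Suc r\<close> gives
        \<open>t / t\<close>, and lower rows vanish by \<open>zero\<close>.\<close>
      also have "\<dots> = mat_unit n i j $$ (a, b)"
        using ab t zero[of a r] Suc by (auto simp: t_def not_le less_eq_Suc_le dest: le_antisym)
      finally show "mat n n (\<lambda>(a, b). \<Sum>k\<in>{..Suc r}. c k * g k $$ (a, b)) $$ (a, b) = mat_unit n i j $$ (a, b)"
        using ab by simp
    qed (auto simp: mat_unit_def)
    finally show ?thesis .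
  qed
qed

lemma transpose_mat_unit: "transpose_mat (mat_unit n i j) = mat_unit n j i"
  by (rule eq_matI) (auto simp: mat_unit_def)

text \<open>Transposition swaps left and right multiplication, so that \<open>mat_unit_rows\<close>
  can also move a unit along row 0.\<close>

lemma mat_subspace_transpose:
  assumes "mat_subspace n V"
  shows "mat_subspace n {x \<in> carrier_mat n n. transpose_mat x \<in> V}"
proof -
  have "transpose_mat (x + y) = transpose_mat x + transpose_mat y"
    if "x \<in> carrier_mat n n" "y \<in> carrier_mat n n" for x y :: "complex mat"
    using that by (intro eq_matI) auto
  moreover have "transpose_mat (c \<cdot>\<^sub>m x) = c \<cdot>\<^sub>m transpose_mat x" for c and x :: "complex mat"
    by (intro eq_matI) auto
  moreover have "transpose_mat (0\<^sub>m n n) = (0\<^sub>m n n :: complex mat)"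
    by (intro eq_matI) auto
  ultimately show ?thesis
    using assms by (auto simp: mat_subspace_def)
qed

text \<open>First the pairs with zero second component are shown to fill the matrix factor.
  Subtracting the matrix identity from the unit of the sum then isolates the identity of the second
  factor, which cuts out \<open>f\<close>; its distinct values generate the rest.\<close>

lemma generates_mat_calg_sum:
  assumes N: "0 < N" and T: "T \<in> carrier_mat N N"
    and sub: "\<And>i. Suc i < N \<Longrightarrow> T $$ (Suc i, i) \<noteq> 0"
    and super: "\<And>i. Suc i < N \<Longrightarrow> T $$ (i, Suc i) \<noteq> 0"
    and zero: "\<And>i j. i < N \<Longrightarrow> j < N \<Longrightarrow> Suc j < i \<or> Suc i < j \<Longrightarrow> T $$ (i, j) = 0"
    and I: "finite I" and inj: "inj_on f I" and f: "f \<in> carrier (complex_power I)"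
  shows "generates_calg (mat_calg N \<oplus>\<^sub>\<C> complex_power I) {(T, f), (mat_unit N 0 0, \<lambda>i\<in>I. 0)}"
  unfolding generates_calg_def
proof (intro allI impI)
  let ?P = "complex_power I" and ?C = "mat_calg N \<oplus>\<^sub>\<C> complex_power I"
  let ?z = "\<zero>\<^bsub>?P\<^esub>"
  fix U assume U: "unital_subalgebra U ?C" and gens: "{(T, f), (mat_unit N 0 0, \<lambda>i\<in>I. 0)} \<subseteq> U"
  interpret P: ring ?P by (rule ring_complex_power)
  have a: "(T, f) \<in> U" and e: "(mat_unit N 0 0, ?z) \<in> U" using gens by simp_all
  \<comment> \<open>Arithmetic with \<open>?z\<close> is stated in ring notation: the proofs that
    \<open>V\<close> is closed under sums, scalars and \<open>T\<close> delete
    \<open>complex_power_simps\<close>, which would unfold \<open>?z\<close>.\<close>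
  have zsm: "c \<odot>\<^bsub>?P\<^esub> ?z = ?z" for c by (auto simp: fun_eq_iff)
  have fz: "f \<otimes>\<^bsub>?P\<^esub> ?z = ?z" "?z \<otimes>\<^bsub>?P\<^esub> f = ?z" by (rule P.r_null[OF f], rule P.l_null[OF f])
  have zz: "?z \<oplus>\<^bsub>?P\<^esub> ?z = ?z" by (rule P.l_zero[OF P.zero_closed])
  define V where "V = {Y. (Y, ?z) \<in> U}"
  have V: "mat_subspace N V"
    unfolding mat_subspace_def
  proof (intro conjI ballI allI)
    show "V \<subseteq> carrier_mat N N"
      using unital_subalgebraD(1)[OF U] by (auto simp: V_def)
    show "0\<^sub>m N N \<in> V"
      using unital_subalgebraD(2)[OF U] by (simp add: V_def)
    show "x + y \<in> V" if "x \<in> V" "y \<in> V" for x y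
      using unital_subalgebraD(6)[OF U, of "(x, ?z)" "(y, ?z)"] that zz
      by (simp add: V_def del: complex_power_simps)
    show "c \<cdot>\<^sub>m x \<in> V" if "x \<in> V" for c x
      using unital_subalgebraD(7)[OF U, of "(x, ?z)" c] that zsm
      by (simp add: V_def del: complex_power_simps)
  qed
  have left: "T * x \<in> V" if "x \<in> V" for x
    using unital_subalgebraD(5)[OF U a, of "(x, ?z)"] that fz
    by (simp add: V_def del: complex_power_simps)
  have right: "x * T \<in> V" if "x \<in> V" for x
    using unital_subalgebraD(5)[OF U _ a, of "(x, ?z)"] that fz
    by (simp add: V_def del: complex_power_simps)
  have u00: "mat_unit N 0 0 \<in> V" using e by (simp add: V_def)
  \<comment> \<open>Right multiplication by \<open>T\<close> becomes left multiplication by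
    \<open>transpose_mat T\<close>. This yields all units of row 0, each of which is then moved down
    its column.\<close>
  have "mat_unit N j 0 \<in> {x \<in> carrier_mat N N. transpose_mat x \<in> V}" if "j < N" for j
  proof (rule mat_unit_rows[OF mat_subspace_transpose[OF V], of "transpose_mat T"])
    fix x assume x: "x \<in> {x \<in> carrier_mat N N. transpose_mat x \<in> V}"
    then have "transpose_mat (transpose_mat T * x) = transpose_mat x * T"
      using T by (subst transpose_mult[of _ N N _ N]) auto
    with x T right show "transpose_mat T * x \<in> {x \<in> carrier_mat N N. transpose_mat x \<in> V}"
      by auto
  qed (use that N T u00 super zero in \<open>auto simp: transpose_mat_unit\<close>)
  then have row0: "mat_unit N 0 j \<in> V" if "j < N" for j
    using that by (auto simp: transpose_mat_unit)
  have "mat_unit N i j \<in> V" if "i < N" "j < N" for i j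
    by (rule mat_unit_rows[OF V T left]) (use row0 that sub zero in auto)
  then have V_all: "V = carrier_mat N N"
    by (rule mat_subspace_all[OF V])
  have idem: "(0\<^sub>m N N, \<one>\<^bsub>?P\<^esub>) \<in> U"
  proof -
    have "(-1) \<cdot>\<^sub>m 1\<^sub>m N \<in> V"
      unfolding V_all by simp
    then have "((-1) \<cdot>\<^sub>m 1\<^sub>m N, ?z) \<in> U"
      unfolding V_def by (rule CollectD)
    then have "((-1) \<cdot>\<^sub>m 1\<^sub>m N, ?z) \<oplus>\<^bsub>?C\<^esub> \<one>\<^bsub>?C\<^esub> \<in> U"
      using unital_subalgebraD(3)[OF U] by (rule unital_subalgebraD(6)[OF U])
    also have "((-1) \<cdot>\<^sub>m 1\<^sub>m N, ?z) \<oplus>\<^bsub>?C\<^esub> \<one>\<^bsub>?C\<^esub> = (0\<^sub>m N N, \<one>\<^bsub>?P\<^esub>)"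
    proof -
      have "(-1) \<cdot>\<^sub>m 1\<^sub>m N + 1\<^sub>m N = (0\<^sub>m N N :: complex mat)"
        by (rule eq_matI) auto
      moreover have "?z \<oplus>\<^bsub>?P\<^esub> \<one>\<^bsub>?P\<^esub> = \<one>\<^bsub>?P\<^esub>"
        by (rule P.l_zero[OF P.one_closed])
      ultimately show ?thesis
        by (simp only: calg_sum_simps mat_calg_simps fst_conv snd_conv)
    qed
    finally show ?thesis .
  qed
  define W where "W = {d \<in> carrier ?P. (0\<^sub>m N N, d) \<in> U}"
  have Wsmult: "c \<odot>\<^bsub>?P\<^esub> d \<in> W" if "d \<in> W" for c d
    using unital_subalgebraD(7)[OF U, of "(0\<^sub>m N N, d)" c] that by (auto simp: W_def)
  have "subring W ?P"
  proof (rule P.subringI)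
    show "\<one>\<^bsub>?P\<^esub> \<in> W" using idem by (auto simp: W_def)
    show "d \<otimes>\<^bsub>?P\<^esub> d' \<in> W" if "d \<in> W" "d' \<in> W" for d d'
      using unital_subalgebraD(5)[OF U, of "(0\<^sub>m N N, d)" "(0\<^sub>m N N, d')"] that
      by (auto simp: W_def)
    show "d \<oplus>\<^bsub>?P\<^esub> d' \<in> W" if "d \<in> W" "d' \<in> W" for d d'
      using unital_subalgebraD(6)[OF U, of "(0\<^sub>m N N, d)" "(0\<^sub>m N N, d')"] that
      by (auto simp: W_def)
    show "\<ominus>\<^bsub>?P\<^esub> d \<in> W" if d: "d \<in> W" for d
    proof -
      have "(-1) \<odot>\<^bsub>?P\<^esub> d = \<ominus>\<^bsub>?P\<^esub> d"
        using d by (intro P.minus_equality[symmetric]) (auto simp: W_def fun_eq_iff)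
      then show ?thesis using Wsmult[OF d, of "-1"] by simp
    qed
  qed (auto simp: W_def)
  then have "unital_subalgebra W ?P"
    using Wsmult by (auto simp: unital_subalgebra_def)
  moreover have "f \<in> W"
  proof -
    have "(T, f) \<otimes>\<^bsub>?C\<^esub> (0\<^sub>m N N, \<one>\<^bsub>?P\<^esub>) \<in> U"
      using a idem by (rule unital_subalgebraD(5)[OF U])
    moreover have "(T, f) \<otimes>\<^bsub>?C\<^esub> (0\<^sub>m N N, \<one>\<^bsub>?P\<^esub>) = (0\<^sub>m N N, f)"
      using T f P.r_one by (simp del: complex_power_simps)
    ultimately show ?thesis using f by (simp add: W_def)
  qed
  ultimately have W_all: "W = carrier ?P"
    using generates_complex_power[OF I inj] by (auto simp: generates_calg_def)
  show "U = carrier ?C"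
  proof
    show "U \<subseteq> carrier ?C" by (rule unital_subalgebraD(1)[OF U])
    show "carrier ?C \<subseteq> U"
    proof
      fix p assume p: "p \<in> carrier ?C"
      then have c: "fst p \<in> carrier_mat N N" "snd p \<in> carrier ?P"
        by (simp_all only: calg_sum_simps mat_calg_simps mem_Times_iff)
      then have "fst p \<in> V" "snd p \<in> W" unfolding V_all W_all by auto
      then have "(fst p, ?z) \<in> U" "(0\<^sub>m N N, snd p) \<in> U" unfolding V_def W_def by blast+
      then have "(fst p, ?z) \<oplus>\<^bsub>?C\<^esub> (0\<^sub>m N N, snd p) \<in> U"
        by (rule unital_subalgebraD(6)[OF U])
      also have "(fst p, ?z) \<oplus>\<^bsub>?C\<^esub> (0\<^sub>m N N, snd p) = (fst p, snd p)"
        using right_add_zero_mat[OF c(1)] P.l_zero[OF c(2)]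
        by (simp only: calg_sum_simps mat_calg_simps fst_conv snd_conv)
      also have "(fst p, snd p) = p" by simp
      finally show "p \<in> U" .
    qed
  qed
qed

section \<open>Cyclic arithmetic on \<open>{0..<n}\<close>\<close>

text \<open>Neighbours on the cycle modulo \<open>n\<close>; case splits in place of
  \<open>mod\<close> keep the index arithmetic linear.\<close>

definition nxt :: "nat \<Rightarrow> nat \<Rightarrow> nat" where
  "nxt n i = (if Suc i = n then 0 else Suc i)"

definition prv :: "nat \<Rightarrow> nat \<Rightarrow> nat" where
  "prv n i = (if i = 0 then n - 1 else i - 1)"

text \<open>The reflection sending \<open>i\<close> to \<open>- i\<close> modulo \<open>n\<close>;
  index 0 is split off because \<open>n - 0\<close> is out of range.\<close>

definition refl_idx :: "nat \<Rightarrow> nat \<Rightarrow> nat" where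
  "refl_idx n i = (if i = 0 then 0 else n - i)"

definition cyc_dist :: "nat \<Rightarrow> nat \<Rightarrow> nat" where
  "cyc_dist n i = min i (n - i)"

text \<open>Subtraction of \<open>x\<close> modulo \<open>n\<close>: the rotation carrying the base
  index to 0, so that basis vectors need be defined only around 0.\<close>

definition shift_idx :: "nat \<Rightarrow> nat \<Rightarrow> nat \<Rightarrow> nat" where
  "shift_idx n x i = (if x \<le> i then i - x else i + n - x)"

lemma nxt_less [simp]: "i < n \<Longrightarrow> nxt n i < n" by (auto simp: nxt_def)
lemma prv_less [simp]: "i < n \<Longrightarrow> prv n i < n" by (auto simp: prv_def)
lemma refl_idx_less [simp]: "i < n \<Longrightarrow> refl_idx n i < n" by (auto simp: refl_idx_def)
lemma shift_idx_less [simp]: "i < n \<Longrightarrow> x < n \<Longrightarrow> shift_idx n x i < n"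
  by (auto simp: shift_idx_def)

text \<open>Here \<open>n \<ge> 3\<close> matters: for \<open>n = 2\<close> the two neighbours
  coincide.\<close>

lemma nxt_neq_prv: "n \<ge> 3 \<Longrightarrow> i < n \<Longrightarrow> nxt n i \<noteq> prv n i"
  by (auto simp: nxt_def prv_def)

lemma refl_idx_refl_idx: "i < n \<Longrightarrow> refl_idx n (refl_idx n i) = i"
  by (auto simp: refl_idx_def)

lemma refl_nxt: "i < n \<Longrightarrow> refl_idx n (nxt n i) = prv n (refl_idx n i)"
  by (auto simp: refl_idx_def nxt_def prv_def)

lemma refl_prv: "i < n \<Longrightarrow> refl_idx n (prv n i) = nxt n (refl_idx n i)"
  by (auto simp: refl_idx_def nxt_def prv_def)

lemma cyc_dist_refl: "i < n \<Longrightarrow> cyc_dist n (refl_idx n i) = cyc_dist n i"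
  by (auto simp: refl_idx_def cyc_dist_def)

lemma cyc_dist_le: "cyc_dist n i \<le> n div 2"
  by (auto simp: cyc_dist_def)

lemma cyc_dist_id: "i \<le> n div 2 \<Longrightarrow> cyc_dist n i = i"
  by (auto simp: cyc_dist_def)

text \<open>The fibres of \<open>cyc_dist\<close> are the orbits of the reflection, so a function
  invariant under it is determined by its values up to \<open>n div 2\<close>.\<close>

lemma cyc_dist_cases:
  assumes "i < n"
  shows "i = cyc_dist n i \<or> i = refl_idx n (cyc_dist n i)"
  using assms by (auto simp: cyc_dist_def refl_idx_def min_def)

lemma shift_nxt: "i < n \<Longrightarrow> x < n \<Longrightarrow> shift_idx n x (nxt n i) = nxt n (shift_idx n x i)"
  by (auto simp: shift_idx_def nxt_def)

lemma shift_prv: "i < n \<Longrightarrow> x < n \<Longrightarrow> shift_idx n x (prv n i) = prv n (shift_idx n x i)"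
  by (auto simp: shift_idx_def prv_def)

lemma shift_idx_eq_0_iff: "i < n \<Longrightarrow> x < n \<Longrightarrow> shift_idx n x i = 0 \<longleftrightarrow> i = x"
  by (auto simp: shift_idx_def)

lemma bij_betw_shift:
  assumes "x < n"
  shows "bij_betw (shift_idx n x) {..<n} {..<n}"
  by (rule bij_betw_byWitness[where f' = "\<lambda>i. if i + x < n then i + x else i + x - n"])
    (use assms in \<open>auto simp: shift_idx_def\<close>)

lemma sum_shift:
  fixes f :: "nat \<Rightarrow> complex"
  assumes "x < n"
  shows "(\<Sum>i<n. f (shift_idx n x i)) = (\<Sum>i<n. f i)"
  using sum.reindex_bij_betw[OF bij_betw_shift[OF assms], of f] by simp

lemma sum_refl:
  fixes f :: "nat \<Rightarrow> complex"
  shows "(\<Sum>i<n. f (refl_idx n i)) = (\<Sum>i<n. f i)"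
proof -
  have "bij_betw (refl_idx n) {..<n} {..<n}"
    by (rule bij_betw_byWitness[where f' = "refl_idx n"]) (auto simp: refl_idx_refl_idx)
  from sum.reindex_bij_betw[OF this, of f] show ?thesis by simp
qed

lemma cycle_edge_iff:
  assumes "n \<ge> 3" "i < n" "j < n"
  shows "{Suc i, Suc j} \<in> cycle_edges n \<longleftrightarrow> j = nxt n i \<or> j = prv n i"
proof -
  \<comment> \<open>Four cases arise because a path edge and the closing edge can each be read in
    both orientations.\<close>
  have "{Suc i, Suc j} \<in> cycle_edges n \<longleftrightarrow>
      j = Suc i \<or> i = Suc j \<or> (Suc i = n \<and> j = 0) \<or> (Suc j = n \<and> i = 0)" (is "?L \<longleftrightarrow> ?R")
  proof
    show "?L \<Longrightarrow> ?R" by (auto simp: cycle_edges_def doubleton_eq_iff)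
    have path: "{Suc k, Suc (Suc k)} \<in> cycle_edges n" if "Suc k < n" for k
      using that unfolding cycle_edges_def by (intro UnI1 CollectI exI[of _ "Suc k"]) simp
    have wrap: "{n, Suc 0} \<in> cycle_edges n" by (simp add: cycle_edges_def)
    assume ?R
    then consider "j = Suc i" | "i = Suc j" | "Suc i = n" "j = 0" | "Suc j = n" "i = 0" by blast
    then show ?L
      by cases (use path[of i] path[of j] wrap assms in \<open>simp_all add: insert_commute\<close>)
  qed
  also have "\<dots> \<longleftrightarrow> j = nxt n i \<or> j = prv n i"
    using assms by (auto simp: nxt_def prv_def)
  finally show ?thesis .
qed

lemma cycle_edges_bounds: "{u, v} \<in> cycle_edges n \<Longrightarrow> n \<ge> 3 \<Longrightarrow> 1 \<le> v \<and> v \<le> n"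
  by (auto simp: cycle_edges_def doubleton_eq_iff)

section \<open>The diameter of the cycle\<close>

text \<open>Induction on the distance, stepping back from \<open>y\<close> to the neighbour
  \<open>z\<close> that is one closer to \<open>x\<close> along a shorter arc.\<close>

lemma relpow_cycle:
  assumes n: "n \<ge> 3" and x: "x < n" and y: "y < n"
  shows "(Suc x, Suc y) \<in> {(u, v). {u, v} \<in> cycle_edges n} ^^ cyc_dist n (shift_idx n x y)"
proof -
  let ?R = "{(u, v). {u, v} \<in> cycle_edges n}"
  have "(Suc x, Suc y) \<in> ?R ^^ c" if "cyc_dist n (shift_idx n x y) = c" "y < n" for c y
    using that
  proof (induction c arbitrary: y)
    case 0
    have "cyc_dist n t = 0 \<Longrightarrow> t < n \<Longrightarrow> t = 0" for t
      by (auto simp: cyc_dist_def)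
    then have "shift_idx n x y = 0" using 0 x by simp
    then show ?case using 0 x by (simp add: shift_idx_eq_0_iff)
  next
    case (Suc c)
    let ?t = "shift_idx n x y"
    have t: "?t < n" using Suc x by simp
    define z where "z = (if ?t \<le> n - ?t then prv n y else nxt n y)"
    have z: "z < n" using Suc by (simp add: z_def)
    have "shift_idx n x z = (if ?t \<le> n - ?t then prv n ?t else nxt n ?t)"
      using Suc.prems x by (simp add: z_def shift_prv shift_nxt)
    moreover have "cyc_dist n (if t \<le> n - t then prv n t else nxt n t) = c"
      if "cyc_dist n t = Suc c" "t < n" for t
      using that by (auto simp: cyc_dist_def prv_def nxt_def min_def split: if_splits)
    ultimately have "cyc_dist n (shift_idx n x z) = c"
      using Suc.prems(1) t by presburger
    then have "(Suc x, Suc z) \<in> ?R ^^ c" using Suc.IH z by blast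
    moreover have "(Suc z, Suc y) \<in> ?R"
    proof -
      have "y = nxt n z \<or> y = prv n z"
        using Suc.prems(2) by (auto simp: z_def prv_def nxt_def)
      then show ?thesis using cycle_edge_iff[OF n z Suc.prems(2)] by simp
    qed
    ultimately show ?case by auto
  qed
  then show ?thesis using y by blast
qed

text \<open>An edge changes the cyclic distance by at most one. The range of \<open>v\<close> is
  carried along because \<open>v - 1\<close> truncates at 0.\<close>

lemma cyc_dist_le_walk:
  assumes n: "n \<ge> 3" and x: "x < n"
    and "(Suc x, v) \<in> {(u, v). {u, v} \<in> cycle_edges n} ^^ k"
  shows "1 \<le> v \<and> v \<le> n \<and> cyc_dist n (shift_idx n x (v - 1)) \<le> k"
  using assms(3)
proof (induction k arbitrary: v)
  case 0
  then show ?case using x by (auto simp: cyc_dist_def shift_idx_def)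
next
  case (Suc k)
  then obtain w where w: "(Suc x, w) \<in> {(u, v). {u, v} \<in> cycle_edges n} ^^ k"
    and e: "{w, v} \<in> cycle_edges n" by auto
  have IH: "1 \<le> w" "w \<le> n" "cyc_dist n (shift_idx n x (w - 1)) \<le> k"
    using Suc.IH[OF w] by auto
  have v: "1 \<le> v" "v \<le> n" using cycle_edges_bounds[OF e n] by auto
  have "v - 1 = nxt n (w - 1) \<or> v - 1 = prv n (w - 1)"
    using cycle_edge_iff[OF n, of "w - 1" "v - 1"] IH v e by auto
  moreover have "cyc_dist n (nxt n t) \<le> Suc (cyc_dist n t)" "cyc_dist n (prv n t) \<le> Suc (cyc_dist n t)"
    if "t < n" for t
    using that by (auto simp: cyc_dist_def nxt_def prv_def)
  moreover have "w - 1 < n" using IH by linarith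
  ultimately have "cyc_dist n (shift_idx n x (v - 1)) \<le> Suc (cyc_dist n (shift_idx n x (w - 1)))"
    using x by (auto simp: shift_nxt shift_prv)
  with IH v show ?case by linarith
qed

lemma graph_dist_cycle:
  assumes "n \<ge> 3" "x < n" "y < n"
  shows "graph_dist (cycle_edges n) (Suc x) (Suc y) = cyc_dist n (shift_idx n x y)"
  unfolding graph_dist_def
proof (rule Least_equality)
  show "(Suc x, Suc y) \<in> {(u, v). {u, v} \<in> cycle_edges n} ^^ cyc_dist n (shift_idx n x y)"
    using assms by (rule relpow_cycle)
qed (use cyc_dist_le_walk[OF assms(1,2)] in fastforce)

lemma graph_diameter_cycle:
  assumes n: "n \<ge> 3"
  shows "graph_diameter n (cycle_edges n) = n div 2"
proof -
  have "{graph_dist (cycle_edges n) x y | x y. x \<in> {1..n} \<and> y \<in> {1..n}}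
      = (\<lambda>(x, y). cyc_dist n (shift_idx n x y)) ` ({..<n} \<times> {..<n})" (is "?L = ?R")
  proof
    show "?L \<subseteq> ?R"
    proof
      fix d assume "d \<in> ?L"
      then obtain x y where "x \<in> {1..n}" "y \<in> {1..n}" "d = graph_dist (cycle_edges n) x y" by auto
      then show "d \<in> ?R"
        using graph_dist_cycle[OF n, of "x - 1" "y - 1"]
        by (intro image_eqI[of _ _ "(x - 1, y - 1)"]) auto
    qed
    show "?R \<subseteq> ?L"
    proof
      fix d assume "d \<in> ?R"
      then obtain x y where xy: "x < n" "y < n" "d = cyc_dist n (shift_idx n x y)" by auto
      then have "d = graph_dist (cycle_edges n) (Suc x) (Suc y)" "Suc x \<in> {1..n}" "Suc y \<in> {1..n}"
        using graph_dist_cycle[OF n] by auto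
      then show "d \<in> ?L" by blast
    qed
  qed
  moreover have "Max ?R = n div 2"
  proof (rule Max_eqI)
    \<comment> \<open>The maximum is attained between index 0 and the opposite index.\<close>
    show "n div 2 \<in> ?R"
      using n by (intro image_eqI[of _ _ "(0, n div 2)"]) (auto simp: shift_idx_def cyc_dist_id)
  qed (auto simp: cyc_dist_le)
  ultimately show ?thesis by (simp add: graph_diameter_def)
qed

section \<open>Roots of unity\<close>

text \<open>The \<open>k\<close>-th power of the standard primitive \<open>n\<close>-th root of
  unity; integer exponents make inverses available as \<open>- k\<close>.\<close>

definition unity :: "nat \<Rightarrow> int \<Rightarrow> complex" where
  "unity n k = cis (2 * pi * of_int k / of_nat n)"

lemma unity_0 [simp]: "unity n 0 = 1"
  by (simp add: unity_def)

lemma unity_add: "unity n (k + l) = unity n k * unity n l"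
  by (simp add: unity_def cis_mult add_divide_distrib distrib_left)

lemma unity_nonzero [simp]: "unity n k \<noteq> 0"
  by (simp add: unity_def)

lemma unity_mult_neg [simp]: "unity n k * unity n (- k) = 1" "unity n (- k) * unity n k = 1"
  by (simp_all flip: unity_add)

lemma unity_eq_1_iff:
  assumes "n > 0"
  shows "unity n k = 1 \<longleftrightarrow> int n dvd k"
proof
  assume "int n dvd k"
  then obtain q where "k = int n * q" ..
  then have "2 * pi * of_int k / of_nat n = 2 * pi * of_int q" using assms by simp
  then show "unity n k = 1" unfolding unity_def by (simp only: cis_multiple_2pi Ints_of_int)
next
  assume "unity n k = 1"
  then have "cos (2 * pi * of_int k / of_nat n) = 1"
    by (simp add: unity_def complex_eq_iff)
  then obtain q :: int where "2 * pi * of_int k / of_nat n = of_int q * 2 * pi"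
    unfolding cos_one_2pi_int by blast
  then have "real_of_int k = real_of_int (q * int n)"
    using assms by (simp add: field_simps)
  then show "int n dvd k" unfolding of_int_eq_iff by simp
qed

lemma unity_cong:
  assumes "n > 0" "int n dvd k - l"
  shows "unity n k = unity n l"
proof -
  have "unity n k = unity n (k - l) * unity n l" by (simp flip: unity_add)
  then show ?thesis using assms by (simp add: unity_eq_1_iff)
qed

lemma unity_power: "unity n k ^ i = unity n (k * int i)"
  by (induction i) (simp_all add: unity_add algebra_simps)

text \<open>Orthogonality of characters: a geometric series whose ratio is a nontrivial
  \<open>n\<close>-th root of unity sums to zero.\<close>

lemma sum_unity:
  assumes "n > 0"
  shows "(\<Sum>i<n. unity n (k * int i)) = (if int n dvd k then of_nat n else 0)"
proof (cases "int n dvd k")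
  case True
  then have "unity n (k * int i) = 1" for i using assms by (simp add: unity_eq_1_iff)
  then show ?thesis using True by simp
next
  case False
  then have "unity n k \<noteq> 1" using assms by (simp add: unity_eq_1_iff)
  then have "(\<Sum>i<n. unity n k ^ i) = (unity n k ^ n - 1) / (unity n k - 1)"
    by (rule geometric_sum)
  also have "unity n k ^ n = 1"
    using assms by (simp add: unity_power unity_eq_1_iff)
  finally show ?thesis using False by (simp add: unity_power)
qed

lemma unity_nxt:
  assumes "t < n"
  shows "unity n (k * int (nxt n t)) = unity n (k * int t) * unity n k"
proof -
  have "unity n (k * int (nxt n t)) = unity n (k * int t + k)"
  proof (rule unity_cong)
    \<comment> \<open>Wrapping from \<open>n - 1\<close> to 0 lowers the index by exactly
      \<open>n\<close>, which the root of unity does not see.\<close>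
    have "int (nxt n t) - (int t + 1) = int n * (if Suc t = n then - 1 else 0)"
      by (auto simp: nxt_def)
    then have "int n dvd int (nxt n t) - (int t + 1)" by (rule dvdI)
    then have "int n dvd k * (int (nxt n t) - (int t + 1))" by (rule dvd_mult)
    then show "int n dvd k * int (nxt n t) - (k * int t + k)" by (simp add: algebra_simps)
  qed (use assms in simp)
  then show ?thesis by (simp add: unity_add)
qed

lemma nxt_prv: "t < n \<Longrightarrow> nxt n (prv n t) = t"
  by (auto simp: nxt_def prv_def)

lemma unity_prv:
  assumes "t < n"
  shows "unity n (k * int (prv n t)) = unity n (k * int t) * unity n (- k)"
  using unity_nxt[of "prv n t" n k] assms by (simp add: nxt_prv mult.assoc)

lemma unity_refl:
  assumes "t < n"
  shows "unity n (k * int (refl_idx n t)) = unity n (- (k * int t))"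
proof (rule unity_cong)
  have "k * int (refl_idx n t) - - (k * int t) = (if t = 0 then 0 else int n * k)"
    using assms by (auto simp: refl_idx_def algebra_simps of_nat_diff)
  then show "int n dvd k * int (refl_idx n t) - - (k * int t)" by simp
qed (use assms in simp)

text \<open>\<open>2 cos (2 \<pi> k / n)\<close>\<close>

definition cycle_eigenvalue :: "nat \<Rightarrow> int \<Rightarrow> complex" where
  "cycle_eigenvalue n k = unity n k + unity n (- k)"

text \<open>The difference of two eigenvalues factors, so equality forces \<open>k\<close> and
  \<open>l\<close> to agree modulo \<open>n\<close> up to sign. Within \<open>{..n div 2}\<close>
  the sum \<open>k + l\<close> is divisible by \<open>n\<close> only if both are 0 or both are half
  of \<open>n\<close>.\<close>

lemma inj_on_cycle_eigenvalue:
  assumes "n > 0"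
  shows "inj_on (\<lambda>k. cycle_eigenvalue n (int k)) {..n div 2}"
proof (rule inj_onI)
  fix k l assume kl: "k \<in> {..n div 2}" "l \<in> {..n div 2}"
    and eq: "cycle_eigenvalue n (int k) = cycle_eigenvalue n (int l)"
  have "(unity n (int k) - unity n (int l)) * (1 - unity n (- int k - int l))
      = cycle_eigenvalue n (int k) - cycle_eigenvalue n (int l)"
  proof -
    have "unity n (int k) * unity n (- int k - int l) = unity n (- int l)"
      "unity n (int l) * unity n (- int k - int l) = unity n (- int k)"
      by (simp_all flip: unity_add)
    then show ?thesis by (simp add: cycle_eigenvalue_def algebra_simps)
  qed
  with eq consider "unity n (int k) = unity n (int l)" | "unity n (- int k - int l) = 1"
    by auto
  then show "k = l"
  proof cases
    case 1
    then have "unity n (int k - int l) = 1"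
      using unity_add[of n "int k - int l" "int l"] by simp
    then have "int n dvd int k - int l" using assms by (simp add: unity_eq_1_iff)
    moreover have "\<bar>int k - int l\<bar> < int n" using kl assms by auto
    ultimately show ?thesis using zdvd_imp_le[of "int n" "\<bar>int k - int l\<bar>"] by fastforce
  next
    case 2
    then have "int n dvd - int k - int l" using assms by (simp add: unity_eq_1_iff)
    then have "int n dvd int (k + l)" using dvd_minus_iff[of "int n" "int (k + l)"] by simp
    then have "n dvd k + l" by (simp only: int_dvd_int_iff)
    then have "k + l = 0 \<or> n \<le> k + l" using dvd_imp_le by blast
    then show ?thesis using kl by auto
  qed
qed

section \<open>Conjugates of block diagonal embeddings\<close>

lemma calg_homI:
  assumes "\<And>x. x \<in> carrier A \<Longrightarrow> h x \<in> carrier B"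
    "\<And>x y. x \<in> carrier A \<Longrightarrow> y \<in> carrier A \<Longrightarrow> h (x \<otimes>\<^bsub>A\<^esub> y) = h x \<otimes>\<^bsub>B\<^esub> h y"
    "\<And>x y. x \<in> carrier A \<Longrightarrow> y \<in> carrier A \<Longrightarrow> h (x \<oplus>\<^bsub>A\<^esub> y) = h x \<oplus>\<^bsub>B\<^esub> h y"
    "h \<one>\<^bsub>A\<^esub> = \<one>\<^bsub>B\<^esub>"
    "\<And>c x. x \<in> carrier A \<Longrightarrow> h (c \<odot>\<^bsub>A\<^esub> x) = c \<odot>\<^bsub>B\<^esub> h x"
  shows "h \<in> calg_hom A B"
  using assms by (auto simp: calg_hom_def intro!: ring_hom_memI)

lemma calg_homD:
  assumes "h \<in> calg_hom A B"
  shows "\<And>x. x \<in> carrier A \<Longrightarrow> h x \<in> carrier B"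
    "\<And>x y. x \<in> carrier A \<Longrightarrow> y \<in> carrier A \<Longrightarrow> h (x \<otimes>\<^bsub>A\<^esub> y) = h x \<otimes>\<^bsub>B\<^esub> h y"
    "\<And>x y. x \<in> carrier A \<Longrightarrow> y \<in> carrier A \<Longrightarrow> h (x \<oplus>\<^bsub>A\<^esub> y) = h x \<oplus>\<^bsub>B\<^esub> h y"
    "h \<one>\<^bsub>A\<^esub> = \<one>\<^bsub>B\<^esub>"
    "\<And>c x. x \<in> carrier A \<Longrightarrow> h (c \<odot>\<^bsub>A\<^esub> x) = c \<odot>\<^bsub>B\<^esub> h x"
  using assms unfolding calg_hom_def by (auto dest: ring_hom_memE)

lemma conj_calg_hom:
  assumes h: "h \<in> calg_hom A (mat_calg n)"
    and P: "P \<in> carrier_mat n n" and Q: "Q \<in> carrier_mat n n"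
    and PQ: "P * Q = 1\<^sub>m n" and QP: "Q * P = 1\<^sub>m n"
  shows "(\<lambda>z. P * h z * Q) \<in> calg_hom A (mat_calg n)"
proof (rule calg_homI)
  note h = calg_homD[OF h, simplified]
  show "P * h z * Q \<in> carrier (mat_calg n)" if "z \<in> carrier A" for z
    using that P Q h(1) by auto
  show "P * h \<one>\<^bsub>A\<^esub> * Q = \<one>\<^bsub>mat_calg n\<^esub>"
    using P PQ by (simp add: h(4))
  fix x assume "x \<in> carrier A"
  note x = this h(1)[OF this]
  show "P * h (c \<odot>\<^bsub>A\<^esub> x) * Q = c \<odot>\<^bsub>mat_calg n\<^esub> (P * h x * Q)" for c
    using x P Q by (simp add: h(5) mult_smult_distrib[of _ n n _ n] mult_smult_assoc_mat[of _ n n _ n])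
  fix y assume "y \<in> carrier A"
  note y = this h(1)[OF this]
  show "P * h (x \<oplus>\<^bsub>A\<^esub> y) * Q = P * h x * Q \<oplus>\<^bsub>mat_calg n\<^esub> P * h y * Q"
    using x y P Q
    by (simp add: h(3) mult_add_distrib_mat[of _ n n _ n] add_mult_distrib_mat[of _ n n _ _ n])
  have "P * h x * Q * (P * h y * Q) = P * h x * (Q * P * (h y * Q))"
    using x(2) y(2) P Q by (simp add: assoc_mult_mat[of _ n n _ n _ n])
  also have "\<dots> = P * (h x * h y) * Q"
    using x(2) y(2) P Q QP by (simp add: assoc_mult_mat[of _ n n _ n _ n])
  finally show "P * h (x \<otimes>\<^bsub>A\<^esub> y) * Q = P * h x * Q \<otimes>\<^bsub>mat_calg n\<^esub> (P * h y * Q)"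
    using x(1) y(1) by (simp add: h(2))
qed

text \<open>With the intertwining relation \<open>g z * P = P * h z\<close> as hypothesis, each
  generator is checked by comparing two explicit products, without \<open>Q\<close>. The law
  \<open>PQ\<close> follows from \<open>QP\<close> because the matrices are square.\<close>

lemma generated_calg_conj_isomorphic:
  assumes A: "ring A" "smult_closed A" and h: "h \<in> calg_hom A (mat_calg n)" "inj_on h (carrier A)"
    and P: "P \<in> carrier_mat n n" and Q: "Q \<in> carrier_mat n n" and QP: "Q * P = 1\<^sub>m n"
    and S: "S \<subseteq> carrier A" "generates_calg A S"
    and g: "\<And>z. z \<in> S \<Longrightarrow> g z \<in> carrier_mat n n \<and> g z * P = P * h z"
  shows "generated_calg (mat_calg n) (g ` S) \<cong>\<^sub>\<C> A"
proof -
  have PQ: "P * Q = 1\<^sub>m n"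
    by (rule mat_mult_left_right_inverse[OF Q P QP])
  have hc: "h z \<in> carrier_mat n n" if "z \<in> carrier A" for z
    using calg_homD(1)[OF h(1) that] by simp
  have "g z = P * h z * Q" if "z \<in> S" for z
  proof -
    have "P * h z * Q = g z * P * Q" using g[OF that] by simp
    also have "\<dots> = g z * (P * Q)"
      using g[OF that] P Q by (intro assoc_mult_mat) auto
    finally show ?thesis using g[OF that] PQ by (simp add: right_mult_one_mat[of _ n n])
  qed
  then have img: "g ` S = (\<lambda>z. P * h z * Q) ` S" by auto
  have "h z = Q * (P * h z * Q) * P" if "z \<in> carrier A" for z
  proof -
    have "Q * (P * h z * Q) * P = (Q * P) * h z * (Q * P)"
      using hc[OF that] P Q by (simp add: assoc_mult_mat[of _ n n _ n _ n])
    then show ?thesis using hc[OF that] QP by simp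
  qed
  then have "inj_on (\<lambda>z. P * h z * Q) (carrier A)"
    using h(2) unfolding inj_on_def by metis
  with A ring_mat_calg conj_calg_hom[OF h(1) P Q PQ QP] S show ?thesis
    unfolding img by (intro generated_calg_isomorphic)
qed

section \<open>Diagonal embeddings of powers of the complex numbers\<close>

definition mat_of_diag :: "nat \<Rightarrow> (nat \<Rightarrow> complex) \<Rightarrow> complex mat" where
  "mat_of_diag n d = mat n n (\<lambda>(i, j). if i = j then d i else 0)"

lemma mat_of_diag_carrier [simp]: "mat_of_diag n d \<in> carrier_mat n n"
  by (simp add: mat_of_diag_def)

lemma index_mult_mat_of_diag:
  assumes "B \<in> carrier_mat k n" "i < k" "j < n"
  shows "(B * mat_of_diag n d) $$ (i, j) = B $$ (i, j) * d j"
proof -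
  have "(B * mat_of_diag n d) $$ (i, j) = (\<Sum>l<n. if l = j then B $$ (i, j) * d j else 0)"
    unfolding index_mult_mat_sum[OF assms(1) mat_of_diag_carrier assms(2,3)]
    by (rule sum.cong) (use assms in \<open>auto simp: mat_of_diag_def\<close>)
  then show ?thesis using assms by simp
qed

text \<open>The map \<open>s\<close> may repeat a coordinate along the diagonal; this accommodates
  eigenvalues of multiplicity two.\<close>

lemma mat_of_diag_calg_hom:
  assumes "\<And>i. i < n \<Longrightarrow> s i \<in> I"
  shows "(\<lambda>d. mat_of_diag n (\<lambda>i. d (s i))) \<in> calg_hom (complex_power I) (mat_calg n)"
proof (rule calg_homI)
  fix d d' :: "'a \<Rightarrow> complex"
  have "mat_of_diag n (\<lambda>i. d (s i) * d' (s i)) = mat_of_diag n (\<lambda>i. d (s i)) * mat_of_diag n (\<lambda>i. d' (s i))"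
  proof (rule eq_matI)
    fix i j
    assume "i < dim_row (mat_of_diag n (\<lambda>i. d (s i)) * mat_of_diag n (\<lambda>i. d' (s i)))"
      "j < dim_col (mat_of_diag n (\<lambda>i. d (s i)) * mat_of_diag n (\<lambda>i. d' (s i)))"
    then have "i < n" "j < n" by (auto simp: mat_of_diag_def)
    then show "mat_of_diag n (\<lambda>i. d (s i) * d' (s i)) $$ (i, j) =
        (mat_of_diag n (\<lambda>i. d (s i)) * mat_of_diag n (\<lambda>i. d' (s i))) $$ (i, j)"
      by (subst index_mult_mat_of_diag[of _ n n]) (auto simp: mat_of_diag_def)
  qed (auto simp: mat_of_diag_def)
  moreover have "mat_of_diag n (\<lambda>i. (d \<otimes>\<^bsub>complex_power I\<^esub> d') (s i)) = mat_of_diag n (\<lambda>i. d (s i) * d' (s i))"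
    using assms by (auto simp: mat_of_diag_def intro!: eq_matI)
  ultimately show "mat_of_diag n (\<lambda>i. (d \<otimes>\<^bsub>complex_power I\<^esub> d') (s i)) =
      mat_of_diag n (\<lambda>i. d (s i)) \<otimes>\<^bsub>mat_calg n\<^esub> mat_of_diag n (\<lambda>i. d' (s i))"
    by simp
qed (use assms in \<open>auto simp: mat_of_diag_def intro!: eq_matI\<close>)

lemma inj_on_mat_of_diag:
  assumes "s ` {..<n} = I"
  shows "inj_on (\<lambda>d. mat_of_diag n (\<lambda>i. d (s i))) (carrier (complex_power I))"
proof (rule inj_onI)
  fix d d' assume d: "d \<in> carrier (complex_power I)" "d' \<in> carrier (complex_power I)"
    and eq: "mat_of_diag n (\<lambda>i. d (s i)) = mat_of_diag n (\<lambda>i. d' (s i))"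
  have "d (s i) = d' (s i)" if "i < n" for i
    using arg_cong[OF eq, of "\<lambda>M. M $$ (i, i)"] that by (simp add: mat_of_diag_def)
  then have "d k = d' k" if "k \<in> I" for k using that assms by auto
  then show "d = d'" using d by (intro PiE_ext[of d I "\<lambda>_. UNIV"]) auto
qed

section \<open>Block diagonal embeddings of direct sums\<close>

definition block_diag :: "nat \<Rightarrow> nat \<Rightarrow> complex mat \<Rightarrow> complex mat \<Rightarrow> complex mat" where
  "block_diag a b X Y = four_block_mat X (0\<^sub>m a b) (0\<^sub>m b a) Y"

lemma block_diag_index:
  assumes "X \<in> carrier_mat a a" "Y \<in> carrier_mat b b" "i < a + b" "j < a + b"
  shows "block_diag a b X Y $$ (i, j) =
    (if i < a then if j < a then X $$ (i, j) else 0
     else if j < a then 0 else Y $$ (i - a, j - a))"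
  using assms by (auto simp: block_diag_def)

lemma block_diag_carrier:
  "X \<in> carrier_mat a a \<Longrightarrow> Y \<in> carrier_mat b b \<Longrightarrow> block_diag a b X Y \<in> carrier_mat (a + b) (a + b)"
  by (simp add: block_diag_def)

lemma block_diag_calg_hom:
  assumes h: "h \<in> calg_hom A (mat_calg a)" and k: "k \<in> calg_hom B (mat_calg b)"
  shows "(\<lambda>p. block_diag a b (h (fst p)) (k (snd p))) \<in> calg_hom (A \<oplus>\<^sub>\<C> B) (mat_calg (a + b))"
proof (rule calg_homI)
  note h = calg_homD[OF h, simplified] and k = calg_homD[OF k, simplified]
  show "block_diag a b (h (fst \<one>\<^bsub>A \<oplus>\<^sub>\<C> B\<^esub>)) (k (snd \<one>\<^bsub>A \<oplus>\<^sub>\<C> B\<^esub>)) = \<one>\<^bsub>mat_calg (a + b)\<^esub>"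
    by (auto simp: h(4) k(4) block_diag_def intro!: eq_matI)
  fix p assume "p \<in> carrier (A \<oplus>\<^sub>\<C> B)"
  then have p: "fst p \<in> carrier A" "snd p \<in> carrier B" by auto
  note p = p h(1)[OF p(1)] k(1)[OF p(2)]
  show "block_diag a b (h (fst p)) (k (snd p)) \<in> carrier (mat_calg (a + b))"
    using p by (simp add: block_diag_carrier)
  show "block_diag a b (h (fst (c \<odot>\<^bsub>A \<oplus>\<^sub>\<C> B\<^esub> p))) (k (snd (c \<odot>\<^bsub>A \<oplus>\<^sub>\<C> B\<^esub> p)))
      = c \<odot>\<^bsub>mat_calg (a + b)\<^esub> block_diag a b (h (fst p)) (k (snd p))" for c
    using p by (simp add: h(5) k(5) block_diag_def smult_four_block_mat[of _ a a _ b _ b])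
  fix q assume "q \<in> carrier (A \<oplus>\<^sub>\<C> B)"
  then have q: "fst q \<in> carrier A" "snd q \<in> carrier B" by auto
  note q = q h(1)[OF q(1)] k(1)[OF q(2)]
  show "block_diag a b (h (fst (p \<oplus>\<^bsub>A \<oplus>\<^sub>\<C> B\<^esub> q))) (k (snd (p \<oplus>\<^bsub>A \<oplus>\<^sub>\<C> B\<^esub> q)))
      = block_diag a b (h (fst p)) (k (snd p)) \<oplus>\<^bsub>mat_calg (a + b)\<^esub> block_diag a b (h (fst q)) (k (snd q))"
    using p q by (simp add: h(3) k(3) block_diag_def add_four_block_mat[of _ a a _ b _ b])
  show "block_diag a b (h (fst (p \<otimes>\<^bsub>A \<oplus>\<^sub>\<C> B\<^esub> q))) (k (snd (p \<otimes>\<^bsub>A \<oplus>\<^sub>\<C> B\<^esub> q)))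
      = block_diag a b (h (fst p)) (k (snd p)) \<otimes>\<^bsub>mat_calg (a + b)\<^esub> block_diag a b (h (fst q)) (k (snd q))"
    using p q by (simp add: h(2) k(2) block_diag_def mult_four_block_mat[of _ a a _ b _ b _ _ a _ b])
qed

lemma inj_on_block_diag:
  assumes h: "inj_on h (carrier A)" "h \<in> calg_hom A (mat_calg a)"
    and k: "inj_on k (carrier B)" "k \<in> calg_hom B (mat_calg b)"
  shows "inj_on (\<lambda>p. block_diag a b (h (fst p)) (k (snd p))) (carrier (A \<oplus>\<^sub>\<C> B))"
proof (rule inj_onI)
  note hc = calg_homD(1)[OF h(2), simplified] and kc = calg_homD(1)[OF k(2), simplified]
  fix p q assume pq: "p \<in> carrier (A \<oplus>\<^sub>\<C> B)" "q \<in> carrier (A \<oplus>\<^sub>\<C> B)"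
    and eq: "block_diag a b (h (fst p)) (k (snd p)) = block_diag a b (h (fst q)) (k (snd q))"
  then have pq: "fst p \<in> carrier A" "snd p \<in> carrier B" "fst q \<in> carrier A" "snd q \<in> carrier B"
    by auto
  note c = hc[OF pq(1)] kc[OF pq(2)] hc[OF pq(3)] kc[OF pq(4)]
  have "h (fst p) = h (fst q)"
  proof (rule eq_matI)
    fix i j assume "i < dim_row (h (fst q))" "j < dim_col (h (fst q))"
    then show "h (fst p) $$ (i, j) = h (fst q) $$ (i, j)"
      using c arg_cong[OF eq, of "\<lambda>M. M $$ (i, j)"] by (simp add: block_diag_index)
  qed (use c in auto)
  moreover have "k (snd p) = k (snd q)"
  proof (rule eq_matI)
    fix i j assume "i < dim_row (k (snd q))" "j < dim_col (k (snd q))"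
    then show "k (snd p) $$ (i, j) = k (snd q) $$ (i, j)"
      using c arg_cong[OF eq, of "\<lambda>M. M $$ (a + i, a + j)"] by (simp add: block_diag_index)
  qed (use c in auto)
  ultimately show "p = q"
    using h(1) k(1) pq by (auto simp: inj_on_def prod_eq_iff)
qed

section \<open>The adjacency algebra of the cycle\<close>

lemma adjacency_mat_carrier [simp]: "adjacency_mat n E \<in> carrier_mat n n"
  by (simp add: adjacency_mat_def)

text \<open>Row \<open>i\<close> of the adjacency matrix has its ones exactly at the two neighbours,
  which are distinct since \<open>n \<ge> 3\<close>.\<close>

lemma index_adjacency_cycle_mult:
  assumes n: "n \<ge> 3" and B: "B \<in> carrier_mat n m" and ij: "i < n" "j < m"
  shows "(adjacency_mat n (cycle_edges n) * B) $$ (i, j) = B $$ (nxt n i, j) + B $$ (prv n i, j)"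
proof -
  have "(adjacency_mat n (cycle_edges n) * B) $$ (i, j)
      = (\<Sum>l<n. if l \<in> {nxt n i, prv n i} then B $$ (l, j) else 0)"
    unfolding index_mult_mat_sum[OF adjacency_mat_carrier B ij]
    by (rule sum.cong) (use n ij cycle_edge_iff[OF n ij(1)] in \<open>auto simp: adjacency_mat_def\<close>)
  also have "\<dots> = (\<Sum>l\<in>{nxt n i, prv n i}. B $$ (l, j))"
    using ij by (subst sum.inter_restrict[symmetric]) (auto intro!: sum.cong)
  finally show ?thesis using nxt_neq_prv[OF n ij(1)] by simp
qed

section \<open>The discrete Fourier basis\<close>

definition dft_mat :: "nat \<Rightarrow> complex mat" where
  "dft_mat n = mat n n (\<lambda>(j, k). unity n (int k * int j))"

definition inv_dft_mat :: "nat \<Rightarrow> complex mat" where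
  "inv_dft_mat n = mat n n (\<lambda>(k, j). unity n (- (int k * int j)) / of_nat n)"

lemma int_dvd_diff_iff:
  assumes "i < n" "j < n"
  shows "int n dvd int i - int j \<longleftrightarrow> i = j"
proof
  assume "int n dvd int i - int j"
  then show "i = j" using assms zdvd_imp_le[of "int n" "\<bar>int i - int j\<bar>"] by fastforce
qed simp

text \<open>Entry \<open>(i, j)\<close> is a normalised character sum of frequency
  \<open>j - i\<close>, which \<open>sum_unity\<close> evaluates.\<close>

lemma inv_dft_mult_dft:
  assumes "n > 0"
  shows "inv_dft_mat n * dft_mat n = 1\<^sub>m n"
proof (rule eq_matI)
  fix i j assume "i < dim_row (1\<^sub>m n :: complex mat)" "j < dim_col (1\<^sub>m n :: complex mat)"
  then have ij: "i < n" "j < n" by auto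
  have "(inv_dft_mat n * dft_mat n) $$ (i, j) = (\<Sum>l<n. unity n (- (int i * int l)) / of_nat n * unity n (int j * int l))"
    using ij by (subst index_mult_mat_sum[of _ n n _ n]) (auto simp: dft_mat_def inv_dft_mat_def intro!: sum.cong)
  also have "\<dots> = (\<Sum>l<n. unity n ((int j - int i) * int l)) / of_nat n"
    by (simp add: sum_divide_distrib algebra_simps flip: unity_add)
  also have "\<dots> = 1\<^sub>m n $$ (i, j)"
    using assms ij by (auto simp: sum_unity int_dvd_diff_iff)
  finally show "(inv_dft_mat n * dft_mat n) $$ (i, j) = 1\<^sub>m n $$ (i, j)" .
qed (auto simp: dft_mat_def inv_dft_mat_def)

text \<open>The frequencies \<open>k\<close> and \<open>n - k\<close> share their eigenvalue, so
  only those up to \<open>n div 2\<close> count.\<close>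

lemma cycle_eigenvalue_cyc_dist:
  assumes "k < n"
  shows "cycle_eigenvalue n (int (cyc_dist n k)) = cycle_eigenvalue n (int k)"
proof -
  have "unity n (int (n - k)) = unity n (- int k)" "unity n (- int (n - k)) = unity n (int k)"
    using assms by (auto intro!: unity_cong)
  then show ?thesis by (auto simp: cyc_dist_def min_def cycle_eigenvalue_def)
qed

text \<open>The target coordinates are the eigenvalues without repetition: column \<open>k\<close>
  of the Fourier basis belongs to coordinate \<open>cyc_dist n k + 1\<close>, shifted by one because
  the index set starts at 1.\<close>

lemma T0_cycle_isomorphic:
  assumes n: "n \<ge> 3"
  shows "T0 n (cycle_edges n) x \<cong>\<^sub>\<C> complex_power {1..n div 2 + 1}"
proof -
  let ?I = "{1..n div 2 + 1}"
  define f where "f = (\<lambda>k\<in>?I. cycle_eigenvalue n (int (k - 1)))"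
  let ?s = "\<lambda>k. cyc_dist n k + 1"
  let ?h = "\<lambda>d. mat_of_diag n (\<lambda>k. d (?s k))"
  have range: "?s ` {..<n} = ?I"
  proof
    show "?s ` {..<n} \<subseteq> ?I" by (auto simp: cyc_dist_le)
    show "?I \<subseteq> ?s ` {..<n}"
    proof
      fix k assume "k \<in> ?I"
      then show "k \<in> ?s ` {..<n}"
        using n by (intro image_eqI[of _ _ "k - 1"]) (auto simp: cyc_dist_id)
    qed
  qed
  have "inj_on f ?I"
  proof (rule inj_onI)
    fix k l assume kl: "k \<in> ?I" "l \<in> ?I" "f k = f l"
    then have "k - 1 = l - 1"
      using inj_on_cycle_eigenvalue[of n] n by (auto simp: f_def inj_on_def)
    then show "k = l" using kl by auto
  qed
  then have gen: "generates_calg (complex_power ?I) {f}"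
    by (rule generates_complex_power[OF finite_atLeastAtMost])
  \<comment> \<open>Each Fourier column is an eigenvector: passing to a neighbour multiplies a
    character by a root of unity or by its inverse.\<close>
  have "adjacency_mat n (cycle_edges n) * dft_mat n = dft_mat n * ?h f"
  proof (rule eq_matI)
    fix j k assume "j < dim_row (dft_mat n * ?h f)" "k < dim_col (dft_mat n * ?h f)"
    then have jk: "j < n" "k < n" by (auto simp: dft_mat_def mat_of_diag_def)
    have dft: "dft_mat n \<in> carrier_mat n n" by (simp add: dft_mat_def)
    have "f (?s k) = cycle_eigenvalue n (int k)"
      using jk cyc_dist_le[of n k] by (simp add: f_def cycle_eigenvalue_cyc_dist)
    then show "(adjacency_mat n (cycle_edges n) * dft_mat n) $$ (j, k) = (dft_mat n * ?h f) $$ (j, k)"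
      using jk unfolding index_adjacency_cycle_mult[OF n dft jk] index_mult_mat_of_diag[OF dft jk]
      by (simp add: dft_mat_def unity_nxt unity_prv cycle_eigenvalue_def algebra_simps)
  qed (auto simp: dft_mat_def mat_of_diag_def adjacency_mat_def)
  then have "generated_calg (mat_calg n) ((\<lambda>_. adjacency_mat n (cycle_edges n)) ` {f}) \<cong>\<^sub>\<C> complex_power ?I"
    using n gen range
    by (intro generated_calg_conj_isomorphic[where h = ?h and P = "dft_mat n" and Q = "inv_dft_mat n"]
        ring_complex_power smult_closed_complex_power mat_of_diag_calg_hom inj_on_mat_of_diag inv_dft_mult_dft)
      (auto simp: dft_mat_def inv_dft_mat_def f_def cyc_dist_le)
  then show ?thesis by (simp add: T0_def)
qed

section \<open>The Terwilliger algebra of the cycle\<close>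

definition sine_vec :: "nat \<Rightarrow> nat \<Rightarrow> nat \<Rightarrow> complex" where
  "sine_vec n k t = unity n (int k * int t) - unity n (- (int k * int t))"

text \<open>Columns \<open>0, \<dots>, n div 2\<close> are the indicators of the distance classes of the base vertex, a basis
  of the vectors symmetric about it; the other columns are \<open>2\<i> sin (2 \<pi> k t / n)\<close>, an eigenbasis of
  the antisymmetric vectors.\<close>

definition basis_vec :: "nat \<Rightarrow> nat \<Rightarrow> nat \<Rightarrow> complex" where
  "basis_vec n c t = (if c \<le> n div 2 then if cyc_dist n t = c then 1 else 0
     else sine_vec n (c - n div 2) t)"

definition basis_mat :: "nat \<Rightarrow> nat \<Rightarrow> complex mat" where
  "basis_mat n x = mat n n (\<lambda>(j, c). basis_vec n c (shift_idx n x j))"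

text \<open>The bilinear square, without conjugation; it is negative for the sine columns, which are
  purely imaginary.\<close>

definition basis_norm :: "nat \<Rightarrow> nat \<Rightarrow> complex" where
  "basis_norm n c = (\<Sum>t<n. basis_vec n c t * basis_vec n c t)"

text \<open>For orthogonal columns the inverse is the transpose with each row divided by its
  norm.\<close>

definition inv_basis_mat :: "nat \<Rightarrow> nat \<Rightarrow> complex mat" where
  "inv_basis_mat n x = mat n n (\<lambda>(c, j). basis_vec n c (shift_idx n x j) / basis_norm n c)"

lemma basis_mat_carrier [simp]: "basis_mat n x \<in> carrier_mat n n"
  by (simp add: basis_mat_def)

lemma inv_basis_mat_carrier [simp]: "inv_basis_mat n x \<in> carrier_mat n n"
  by (simp add: inv_basis_mat_def)

lemma sine_vec_refl: "t < n \<Longrightarrow> sine_vec n k (refl_idx n t) = - sine_vec n k t"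
  using unity_refl[of t n "int k"] unity_refl[of t n "- int k"] by (simp add: sine_vec_def)

lemma sine_vec_nxt_prv:
  assumes "t < n"
  shows "sine_vec n k (nxt n t) + sine_vec n k (prv n t) = sine_vec n k t * cycle_eigenvalue n (int k)"
  using unity_nxt[OF assms, of "int k"] unity_nxt[OF assms, of "- int k"]
    unity_prv[OF assms, of "int k"] unity_prv[OF assms, of "- int k"]
  by (simp add: sine_vec_def cycle_eigenvalue_def algebra_simps)

text \<open>The product of two sines is a combination of four characters. The bounds give
  \<open>0 < k + l < n\<close>, so the two of frequency \<open>k + l\<close> up to sign sum to zero;
  the other two survive only for \<open>k = l\<close>.\<close>

lemma sum_sine_vec_mult:
  assumes k: "0 < k" "2 * k < n" and l: "0 < l" "2 * l < n"
  shows "(\<Sum>t<n. sine_vec n k t * sine_vec n l t) = (if k = l then - 2 * of_nat n else 0)"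
proof -
  have n: "n > 0" using k by simp
  have "sine_vec n k t * sine_vec n l t =
      unity n (int (k + l) * int t) + unity n (- int (k + l) * int t)
      - unity n ((int k - int l) * int t) - unity n ((int l - int k) * int t)" for t
    by (simp add: sine_vec_def algebra_simps flip: unity_add)
  then have "(\<Sum>t<n. sine_vec n k t * sine_vec n l t) =
      (\<Sum>t<n. unity n (int (k + l) * int t)) + (\<Sum>t<n. unity n (- int (k + l) * int t))
      - (\<Sum>t<n. unity n ((int k - int l) * int t)) - (\<Sum>t<n. unity n ((int l - int k) * int t))"
    by (simp only: sum.distrib sum_subtractf)
  moreover have "\<not> int n dvd int (k + l)"
    using k l by (simp only: int_dvd_int_iff) (auto dest: dvd_imp_le)
  moreover have "\<not> int n dvd - int (k + l)"
    using \<open>\<not> int n dvd int (k + l)\<close> by (simp only: dvd_minus_iff not_False_eq_True)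
  moreover have "int n dvd int k - int l \<longleftrightarrow> k = l" "int n dvd int l - int k \<longleftrightarrow> k = l"
    using k l int_dvd_diff_iff[of k n l] int_dvd_diff_iff[of l n k] by auto
  ultimately show ?thesis
    by (simp only: sum_unity[OF n]) simp
qed

lemma basis_vec_orthogonal:
  assumes c: "c < n" "d < n" "c \<noteq> d"
  shows "(\<Sum>t<n. basis_vec n c t * basis_vec n d t) = 0"
proof -
  \<comment> \<open>The product of a symmetric and an antisymmetric vector changes sign under the
    reflection, so its sum equals its own negative.\<close>
  have mixed: "(\<Sum>t<n. basis_vec n c t * basis_vec n d t) = 0"
    if "c \<le> n div 2" "\<not> d \<le> n div 2" for c d
  proof -
    let ?f = "\<lambda>t. basis_vec n c t * basis_vec n d t"
    have "(\<Sum>t<n. ?f t) = (\<Sum>t<n. ?f (refl_idx n t))" by (rule sum_refl[symmetric])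
    also have "\<dots> = (\<Sum>t<n. - ?f t)"
      using that by (intro sum.cong) (auto simp: basis_vec_def cyc_dist_refl sine_vec_refl)
    finally show ?thesis by (simp add: sum_negf)
  qed
  consider "c \<le> n div 2" "d \<le> n div 2" | "c \<le> n div 2" "\<not> d \<le> n div 2"
    | "\<not> c \<le> n div 2" "d \<le> n div 2" | "\<not> c \<le> n div 2" "\<not> d \<le> n div 2" by blast
  then show ?thesis
  proof cases
    case 1
    then show ?thesis using c by (intro sum.neutral) (auto simp: basis_vec_def)
  next
    case 2
    then show ?thesis by (rule mixed)
  next
    case 3
    then show ?thesis using mixed[of d c] by (simp add: mult.commute)
  next
    case 4
    have "(\<Sum>t<n. sine_vec n (c - n div 2) t * sine_vec n (d - n div 2) t) = 0"
      using 4 c by (subst sum_sine_vec_mult) auto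
    then show ?thesis using 4 by (simp add: basis_vec_def)
  qed
qed

text \<open>For an indicator this is the size of a nonempty distance class, for a sine column it is
  \<open>- 2 * of_nat n\<close>.\<close>

lemma basis_norm_nonzero:
  assumes c: "c < n"
  shows "basis_norm n c \<noteq> 0"
proof (cases "c \<le> n div 2")
  case True
  then have "basis_norm n c = (\<Sum>t<n. if cyc_dist n t = c then 1 else 0)"
    by (auto simp: basis_norm_def basis_vec_def intro!: sum.cong)
  also have "\<dots> = of_nat (card {t \<in> {..<n}. cyc_dist n t = c})"
    by (simp add: sum.If_cases Int_def)
  finally have "basis_norm n c = of_nat (card {t \<in> {..<n}. cyc_dist n t = c})" .
  moreover have "card {t \<in> {..<n}. cyc_dist n t = c} \<noteq> 0"
    using c True cyc_dist_id[of c n] by auto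
  ultimately show ?thesis by simp
next
  case False
  then have "basis_norm n c = - 2 * of_nat n"
    using c unfolding basis_norm_def basis_vec_def
    by (simp, subst sum_sine_vec_mult) auto
  then show ?thesis using c by simp
qed

lemma inv_basis_mult_basis:
  assumes x: "x < n"
  shows "inv_basis_mat n x * basis_mat n x = 1\<^sub>m n"
proof (rule eq_matI)
  fix c d assume "c < dim_row (1\<^sub>m n :: complex mat)" "d < dim_col (1\<^sub>m n :: complex mat)"
  then have cd: "c < n" "d < n" by auto
  let ?f = "\<lambda>t. basis_vec n c t * basis_vec n d t / basis_norm n c"
  have "(inv_basis_mat n x * basis_mat n x) $$ (c, d) = (\<Sum>j<n. ?f (shift_idx n x j))"
    unfolding index_mult_mat_sum[OF inv_basis_mat_carrier basis_mat_carrier cd]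
    by (rule sum.cong) (use cd in \<open>auto simp: inv_basis_mat_def basis_mat_def\<close>)
  also have "\<dots> = (\<Sum>t<n. ?f t)" by (rule sum_shift[OF x])
  also have "\<dots> = (\<Sum>t<n. basis_vec n c t * basis_vec n d t) / basis_norm n c"
    by (simp add: sum_divide_distrib)
  also have "\<dots> = 1\<^sub>m n $$ (c, d)"
    using cd basis_vec_orthogonal[OF cd] basis_norm_nonzero[OF cd(1)]
    by (cases "c = d") (auto simp: basis_norm_def)
  finally show "(inv_basis_mat n x * basis_mat n x) $$ (c, d) = 1\<^sub>m n $$ (c, d)" .
qed (auto simp: inv_basis_mat_def basis_mat_def)

text \<open>Among the symmetric columns, row \<open>j\<close> of the basis has a single one, in
  column \<open>cyc_dist n (shift_idx n x j)\<close>, which selects a row of \<open>X\<close>.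
  Position \<open>i\<close> of the lower block belongs to frequency \<open>Suc i\<close>, whence the
  argument of \<open>d\<close>.\<close>

lemma index_basis_mult_block_diag:
  assumes x: "x < n" and jc: "j < n" "c < n" and n: "n div 2 + 1 + m = n"
    and X: "X \<in> carrier_mat (n div 2 + 1) (n div 2 + 1)"
  shows "(basis_mat n x * block_diag (n div 2 + 1) m X (mat_of_diag m (\<lambda>i. d (Suc i)))) $$ (j, c) =
    (if c \<le> n div 2 then X $$ (cyc_dist n (shift_idx n x j), c)
     else basis_vec n c (shift_idx n x j) * d (c - n div 2))"
proof -
  let ?t = "shift_idx n x j"
  define B where "B = block_diag (n div 2 + 1) m X (mat_of_diag m (\<lambda>i. d (Suc i)))"
  let ?u = "cyc_dist n ?t"
  have B: "B \<in> carrier_mat n n"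
    using block_diag_carrier[OF X mat_of_diag_carrier[of m "\<lambda>i. d (Suc i)"]] unfolding n B_def .
  have idx: "B $$ (l, c) =
      (if l \<le> n div 2 then if c \<le> n div 2 then X $$ (l, c) else 0
       else if c \<le> n div 2 then 0 else if l = c then d (c - n div 2) else 0)" if "l < n" for l
    using block_diag_index[OF X mat_of_diag_carrier[of m "\<lambda>i. d (Suc i)"], of l c] that jc n
    by (auto simp: B_def mat_of_diag_def Suc_diff_Suc)
  have u: "?u \<le> n div 2" "?u < n" using cyc_dist_le[of n ?t] jc by (auto simp: cyc_dist_def x)
  have "(basis_mat n x * B) $$ (j, c) = (\<Sum>l<n. basis_vec n l ?t * B $$ (l, c))"
    unfolding index_mult_mat_sum[OF basis_mat_carrier B jc]
    by (rule sum.cong) (use jc in \<open>auto simp: basis_mat_def\<close>)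
  also have "\<dots> = (\<Sum>l<n. if l = (if c \<le> n div 2 then ?u else c)
      then if c \<le> n div 2 then X $$ (?u, c) else basis_vec n c ?t * d (c - n div 2) else 0)"
    by (rule sum.cong) (use u jc in \<open>auto simp: idx basis_vec_def\<close>)
  also have "\<dots> = (if c \<le> n div 2 then X $$ (?u, c) else basis_vec n c ?t * d (c - n div 2))"
    using u jc by simp
  finally show ?thesis unfolding B_def .
qed

text \<open>The quotient matrix of the partition into distance classes: the adjacency matrix acting
  on symmetric vectors. For \<open>n \<ge> 3\<close> its entry at \<open>(0, 1)\<close> is 2, and
  for odd \<open>n\<close> the last diagonal entry is 1.\<close>

definition quotient_mat :: "nat \<Rightarrow> complex mat" where
  "quotient_mat n = mat (n div 2 + 1) (n div 2 + 1)
     (\<lambda>(s, c). (if cyc_dist n (nxt n s) = c then 1 else 0) + (if cyc_dist n (prv n s) = c then 1 else 0))"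

lemma quotient_mat_carrier [simp]: "quotient_mat n \<in> carrier_mat (n div 2 + 1) (n div 2 + 1)"
  by (simp add: quotient_mat_def)

text \<open>The partition is equitable: reflection interchanges the two kinds of neighbours, so all
  members of a class see the same neighbouring classes.\<close>

lemma index_quotient_mat_cyc_dist:
  assumes t: "t < n" and c: "c \<le> n div 2"
  shows "quotient_mat n $$ (cyc_dist n t, c) = basis_vec n c (nxt n t) + basis_vec n c (prv n t)"
proof -
  let ?u = "cyc_dist n t"
  have u: "?u < n" using t by (auto simp: cyc_dist_def)
  have Q: "quotient_mat n $$ (?u, c) = basis_vec n c (nxt n ?u) + basis_vec n c (prv n ?u)"
    using c cyc_dist_le[of n t] by (simp add: quotient_mat_def basis_vec_def)
  have "basis_vec n c (nxt n (refl_idx n s)) + basis_vec n c (prv n (refl_idx n s))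
      = basis_vec n c (nxt n s) + basis_vec n c (prv n s)" if "s < n" for s
    using that c by (simp add: basis_vec_def cyc_dist_refl flip: refl_nxt refl_prv)
  then show ?thesis using Q cyc_dist_cases[OF t] u by metis
qed

text \<open>Symmetric columns are handled by the quotient matrix, sine columns by their eigenvector
  equation.\<close>

lemma adjacency_mult_basis:
  assumes n: "n \<ge> 3" and x: "x < n" and m: "n div 2 + 1 + m = n"
    and d: "\<And>k. k \<in> {1..m} \<Longrightarrow> d k = cycle_eigenvalue n (int k)"
  shows "adjacency_mat n (cycle_edges n) * basis_mat n x =
    basis_mat n x * block_diag (n div 2 + 1) m (quotient_mat n) (mat_of_diag m (\<lambda>i. d (Suc i)))"
    (is "?L = ?R")
proof (rule eq_matI)
  have B: "block_diag (n div 2 + 1) m (quotient_mat n) (mat_of_diag m (\<lambda>i. d (Suc i))) \<in> carrier_mat n n"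
    using block_diag_carrier[OF quotient_mat_carrier[of n] mat_of_diag_carrier[of m "\<lambda>i. d (Suc i)"]] unfolding m .
  then show dims: "dim_row ?L = dim_row ?R" "dim_col ?L = dim_col ?R"
    by (auto simp: adjacency_mat_def basis_mat_def)
  fix j c assume "j < dim_row ?R" "c < dim_col ?R"
  then have jc: "j < n" "c < n" using B by (auto simp: basis_mat_def)
  let ?t = "shift_idx n x j"
  have t: "?t < n" using jc x by simp
  have "?L $$ (j, c) = basis_vec n c (nxt n ?t) + basis_vec n c (prv n ?t)"
    unfolding index_adjacency_cycle_mult[OF n basis_mat_carrier jc]
    using jc x by (simp add: basis_mat_def shift_nxt shift_prv)
  also have "\<dots> = ?R $$ (j, c)"
    unfolding index_basis_mult_block_diag[OF x jc m quotient_mat_carrier]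
  proof (cases "c \<le> n div 2")
    case False
    then have "c - n div 2 \<in> {1..m}" using jc m by auto
    then show "basis_vec n c (nxt n ?t) + basis_vec n c (prv n ?t) =
        (if c \<le> n div 2 then quotient_mat n $$ (cyc_dist n ?t, c) else basis_vec n c ?t * d (c - n div 2))"
      using False sine_vec_nxt_prv[OF t] d by (simp add: basis_vec_def)
  qed (simp add: index_quotient_mat_cyc_dist[OF t])
  finally show "?L $$ (j, c) = ?R $$ (j, c)" .
qed

text \<open>Left multiplication keeps only row \<open>x\<close> of the basis. There every column but
  the indicator of distance 0 vanishes, since antisymmetric vectors are zero at the base
  vertex.\<close>

lemma vertex_mult_basis:
  assumes n: "n \<ge> 3" and x: "x < n" and m: "n div 2 + 1 + m = n"
    and d: "\<And>k. k \<in> {1..m} \<Longrightarrow> d k = 0"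
  shows "vertex_mat n (Suc x) * basis_mat n x =
    basis_mat n x * block_diag (n div 2 + 1) m (mat_unit (n div 2 + 1) 0 0) (mat_of_diag m (\<lambda>i. d (Suc i)))"
    (is "?L = ?R")
proof (rule eq_matI)
  have B: "block_diag (n div 2 + 1) m (mat_unit (n div 2 + 1) 0 0) (mat_of_diag m (\<lambda>i. d (Suc i)))
      \<in> carrier_mat n n"
    using block_diag_carrier[OF mat_unit_carrier[of "n div 2 + 1" 0 0] mat_of_diag_carrier[of m "\<lambda>i. d (Suc i)"]] unfolding m .
  then show dims: "dim_row ?L = dim_row ?R" "dim_col ?L = dim_col ?R"
    by (auto simp: vertex_mat_def basis_mat_def)
  fix j c assume "j < dim_row ?R" "c < dim_col ?R"
  then have jc: "j < n" "c < n" using B by (auto simp: basis_mat_def)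
  let ?t = "shift_idx n x j"
  have t: "?t < n" using jc x by simp
  have v: "vertex_mat n (Suc x) \<in> carrier_mat n n" by (simp add: vertex_mat_def)
  have bx: "basis_mat n x $$ (x, c) = (if c = 0 then 1 else 0)"
    using jc x by (auto simp: basis_mat_def shift_idx_def basis_vec_def cyc_dist_def sine_vec_def)
  have "?L $$ (j, c) = (\<Sum>l<n. if l = x then if j = x then basis_mat n x $$ (x, c) else 0 else 0)"
    unfolding index_mult_mat_sum[OF v basis_mat_carrier jc]
    by (rule sum.cong) (use jc in \<open>auto simp: vertex_mat_def\<close>)
  also have "\<dots> = (if j = x \<and> c = 0 then 1 else 0)"
    unfolding bx using x by simp
  also have "\<dots> = ?R $$ (j, c)"
    unfolding index_basis_mult_block_diag[OF x jc m mat_unit_carrier]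
  proof (cases "c \<le> n div 2")
    case False
    then have "c - n div 2 \<in> {1..m}" using jc m by auto
    then show "(if j = x \<and> c = 0 then 1 else 0) =
        (if c \<le> n div 2 then mat_unit (n div 2 + 1) 0 0 $$ (cyc_dist n ?t, c)
         else basis_vec n c ?t * d (c - n div 2))"
      using False d by auto
  next
    case True
    have "cyc_dist n ?t = 0 \<longleftrightarrow> ?t = 0" using t by (auto simp: cyc_dist_def)
    then have "cyc_dist n ?t = 0 \<longleftrightarrow> j = x" using shift_idx_eq_0_iff[OF jc(1) x] by simp
    then show "(if j = x \<and> c = 0 then 1 else 0) =
        (if c \<le> n div 2 then mat_unit (n div 2 + 1) 0 0 $$ (cyc_dist n ?t, c)
         else basis_vec n c ?t * d (c - n div 2))"
      using True cyc_dist_le[of n ?t] by simp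
  qed
  finally show "?L $$ (j, c) = ?R $$ (j, c)" .
qed

text \<open>A step changes the distance by at most one, and within the half circle the steps between
  \<open>i\<close> and \<open>Suc i\<close> do occur in both directions.\<close>

lemma quotient_mat_tridiagonal:
  assumes n: "n \<ge> 3"
  shows "Suc i < n div 2 + 1 \<Longrightarrow> quotient_mat n $$ (Suc i, i) \<noteq> 0"
    and "Suc i < n div 2 + 1 \<Longrightarrow> quotient_mat n $$ (i, Suc i) \<noteq> 0"
    and "i < n div 2 + 1 \<Longrightarrow> j < n div 2 + 1 \<Longrightarrow> Suc j < i \<or> Suc i < j \<Longrightarrow> quotient_mat n $$ (i, j) = 0"
proof -
  show "quotient_mat n $$ (Suc i, i) \<noteq> 0" if i: "Suc i < n div 2 + 1"
  proof -
    have "cyc_dist n (prv n (Suc i)) = i" using i by (simp add: prv_def cyc_dist_id)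
    then show ?thesis using i by (simp add: quotient_mat_def)
  qed
  show "quotient_mat n $$ (i, Suc i) \<noteq> 0" if i: "Suc i < n div 2 + 1"
  proof -
    have "Suc i \<noteq> n" using i n by linarith
    then have "cyc_dist n (nxt n i) = Suc i" using i by (simp add: nxt_def cyc_dist_id)
    then show ?thesis using i by (simp add: quotient_mat_def)
  qed
  show "quotient_mat n $$ (i, j) = 0"
    if ij: "i < n div 2 + 1" "j < n div 2 + 1" "Suc j < i \<or> Suc i < j"
  proof -
    have "2 * i \<le> n" using ij(1) by linarith
    then have "cyc_dist n (nxt n i) \<noteq> j" "cyc_dist n (prv n i) \<noteq> j"
      using ij(3) n by (auto simp: nxt_def prv_def cyc_dist_def min_def)
    then show ?thesis using ij by (simp add: quotient_mat_def)
  qed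
qed

text \<open>Here \<open>m\<close> counts the sine columns, that is the dimension of the
  antisymmetric vectors. The vertex matrix kills these, which explains the zero second component of
  \<open>e\<close>.\<close>

lemma T1_cycle_isomorphic:
  assumes n: "n \<ge> 3" and x: "x < n" and m: "n div 2 + 1 + m = n"
  shows "T1 n (cycle_edges n) (Suc x) \<cong>\<^sub>\<C> mat_calg (n div 2 + 1) \<oplus>\<^sub>\<C> complex_power {1..m}"
proof -
  let ?N = "n div 2 + 1" and ?I = "{1..m}"
  let ?C = "mat_calg ?N \<oplus>\<^sub>\<C> complex_power ?I"
  define f where "f = (\<lambda>k\<in>?I. cycle_eigenvalue n (int k))"
  define a where "a = (quotient_mat n, f)"
  define e where "e = (mat_unit ?N 0 0, \<lambda>k\<in>?I. 0 :: complex)"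
  define k where "k = (\<lambda>d :: nat \<Rightarrow> complex. mat_of_diag m (\<lambda>i. d (Suc i)))"
  define h where "h = (\<lambda>p. block_diag ?N m (fst p) (k (snd p)))"
  \<comment> \<open>\<open>g\<close> recovers each given generator from its preimage; the case split
    is correct for \<open>a\<close> because \<open>a \<noteq> e\<close>, shown below.\<close>
  define g where "g z = (if z = e then vertex_mat n (Suc x) else adjacency_mat n (cycle_edges n))" for z
  have id: "(\<lambda>X. X) \<in> calg_hom (mat_calg ?N) (mat_calg ?N)"
    by (rule calg_homI) auto
  have k: "k \<in> calg_hom (complex_power ?I) (mat_calg m)"
    unfolding k_def by (rule mat_of_diag_calg_hom) auto
  have kinj: "inj_on k (carrier (complex_power ?I))"
    unfolding k_def by (rule inj_on_mat_of_diag) (simp add: image_Suc_lessThan)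
  have h: "h \<in> calg_hom ?C (mat_calg n)"
    using block_diag_calg_hom[OF id k] unfolding h_def m .
  have hinj: "inj_on h (carrier ?C)"
    unfolding h_def by (rule inj_on_block_diag[OF _ id kinj k]) (simp add: inj_on_def)
  have f: "f \<in> carrier (complex_power ?I)" by (simp add: f_def)
  \<comment> \<open>The frequencies 1 to \<open>m\<close> stay within \<open>{..n div 2}\<close>,
    where eigenvalues are distinct.\<close>
  have "inj_on f ?I"
  proof (rule inj_onI)
    fix k l assume kl: "k \<in> ?I" "l \<in> ?I" "f k = f l"
    then have "k \<le> n div 2" "l \<le> n div 2" using m by auto
    then show "k = l"
      using kl inj_on_cycle_eigenvalue[of n] n by (auto simp: f_def inj_on_def)
  qed
  then have gen: "generates_calg ?C {a, e}"
    unfolding a_def e_def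
    by (intro generates_mat_calg_sum quotient_mat_tridiagonal[OF n] f quotient_mat_carrier) auto
  have ae: "{a, e} \<subseteq> carrier ?C"
    using f by (auto simp: a_def e_def quotient_mat_def mat_unit_def)
  have "a \<noteq> e"
  proof
    assume "a = e"
    then have "quotient_mat n $$ (Suc 0, 0) = mat_unit ?N 0 0 $$ (Suc 0, 0)" by (simp add: a_def e_def)
    then show False using quotient_mat_tridiagonal(1)[OF n, of 0] n by simp
  qed
  have gA: "g a * basis_mat n x = basis_mat n x * h a"
    using \<open>a \<noteq> e\<close> adjacency_mult_basis[OF n x m, of f]
    by (simp add: g_def h_def k_def a_def f_def)
  have gE: "g e * basis_mat n x = basis_mat n x * h e"
    using vertex_mult_basis[OF n x m, of "snd e"]
    by (simp add: g_def h_def k_def e_def)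
  have gc: "g z \<in> carrier_mat n n" for z
    by (simp add: g_def vertex_mat_def)
  have "generated_calg (mat_calg n) (g ` {a, e}) \<cong>\<^sub>\<C> ?C"
    by (rule generated_calg_conj_isomorphic[OF _ _ h hinj basis_mat_carrier inv_basis_mat_carrier
          inv_basis_mult_basis[OF x] ae gen])
      (use gA gE gc in \<open>auto intro!: ring_calg_sum smult_closed_calg_sum ring_mat_calg ring_complex_power
        smult_closed_mat_calg smult_closed_complex_power\<close>)
  moreover have "g ` {a, e} = {adjacency_mat n (cycle_edges n), vertex_mat n (Suc x)}"
    using \<open>a \<noteq> e\<close> by (auto simp: g_def)
  ultimately show ?thesis by (simp add: T1_def)
qed

theorem theorem7p7:
  fixes n x\<^sub>0 D :: nat
  assumes "n \<ge> 3" and "x\<^sub>0 \<in> {1..n}" and "D = n div 2"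
  shows "graph_diameter n (cycle_edges n) = D \<and>
    T0 n (cycle_edges n) x\<^sub>0 \<cong>\<^sub>\<C> calg_Sum {1..D + 1} (\<lambda>_. complex_calg) \<and>
    (even n \<longrightarrow>
      T1 n (cycle_edges n) x\<^sub>0 \<cong>\<^sub>\<C>
        mat_calg (D + 1) \<oplus>\<^sub>\<C> calg_Sum {1..D - 1} (\<lambda>_. complex_calg)) \<and>
    (odd n \<longrightarrow>
      T1 n (cycle_edges n) x\<^sub>0 \<cong>\<^sub>\<C>
        mat_calg (D + 1) \<oplus>\<^sub>\<C> calg_Sum {1..D} (\<lambda>_. complex_calg))"
proof (intro conjI impI)
  \<comment> \<open>Vertex \<open>x\<^sub>0\<close> has matrix index
    \<open>x\<^sub>0 - 1\<close>.\<close>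
  have x: "x\<^sub>0 - 1 < n" "Suc (x\<^sub>0 - 1) = x\<^sub>0" using assms(2) by auto
  note T1 = T1_cycle_isomorphic[OF assms(1) x(1), unfolded x(2), folded assms(3)]
  show "graph_diameter n (cycle_edges n) = D"
    using graph_diameter_cycle[OF assms(1)] assms(3) by simp
  show "T0 n (cycle_edges n) x\<^sub>0 \<cong>\<^sub>\<C> calg_Sum {1..D + 1} (\<lambda>_. complex_calg)"
    unfolding assms(3) by (rule T0_cycle_isomorphic[OF assms(1)])
  \<comment> \<open>Here \<open>n = 2 * D\<close>, so \<open>m = D - 1\<close>; in the odd case
    below \<open>n = 2 * D + 1\<close> gives \<open>m = D\<close>.\<close>
  show "T1 n (cycle_edges n) x\<^sub>0 \<cong>\<^sub>\<C> mat_calg (D + 1) \<oplus>\<^sub>\<C> calg_Sum {1..D - 1} (\<lambda>_. complex_calg)"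
    if "even n"
    by (rule T1) (use that assms in presburger)
  show "T1 n (cycle_edges n) x\<^sub>0 \<cong>\<^sub>\<C> mat_calg (D + 1) \<oplus>\<^sub>\<C> calg_Sum {1..D} (\<lambda>_. complex_calg)"
    if "odd n"
    by (rule T1) (use that assms in presburger)
qed

end
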